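(* Let $0<q\leq 1$. Let $D_1\in\mathbb{R}^{n\times d_1}$ and $D_2\in\mathbb{R}^{n\times d_2}$ be two arbitrary tight frames for $\mathbb{R}^n$ with frame bound $1$. Let $A$ be an $m\times n$ matrix whose entries are i.i.d. normally distributed with mean zero and variance $\sigma^2$. Let $f_1,f_2\in\mathbb{R}^n$ and suppose we observe $y=A(f_1+f_2)$. Fix positive integers $s_1,s_2$. Assume that the mutual coherence $\mu_1$ between $D_1$ and $D_2$ satisfies $$\mu_1(s_1+s_2)\left(\left\lceil(2^{3q/2}\cdot 5)^{\frac{2}{2-q}}\right\rceil+1\right)\left(\frac{1}{8\cdot 5^{2/q}}+1\right)<1.$$ Then there exist constants $C_1(q)$ and $C_2(q)$ such that whenever $$m\geq C_1(q)(s_1+s_2)+qC_2(q)(s_1+s_2)\log\left(\frac{d_1+d_2}{s_1+s_2}\right),$$ with probability exceeding $1-1/\binom{d_1+d_2}{s_1+s_2}$, any solution $(\hat{f}_1,\hat{f}_2)$ of $$\min_{\tilde{f}_1,\tilde{f}_2\in\mathbb{R}^n}\|D_1^*\tilde{f}_1\|_q^q+\|D_2^*\tilde{f}_2\|_q^q\quad\text{subject to}\quad A(\tilde{f}_1+\tilde{f}_2)=y$$ obeys $$\|\hat{f}_1-f_1\|_2+\|\hat{f}_2-f_2\|_2\leq C\frac{\left(\|D_1^*f_1-(D_1^*f_1)_{[s_1]}\|_q^q+\|D_2^*f_2-(D_2^*f_2)_{[s_2]}\|_q^q\right)^{1/q}}{(s_1+s_2)^{1/q-1/2}},$$ where $C>0$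 is a constant not depending on $f_1,f_2$.
   Context: A tight frame for $\mathbb{R}^n$ with frame bound $1$ is a matrix $D\in\mathbb{R}^{n\times d}$ with $\|D^*f\|_2^2=\|f\|_2^2$ for all $f\in\mathbb{R}^n$ (equivalently $DD^*=I$). If $D_1$ has columns $d_{11},\dots,d_{1d_1}$ and $D_2$ has columns $d_{21},\dots,d_{2d_2}$, their mutual coherence is $\mu_1=\max_{i,j}|\langle d_{1i},d_{2j}\rangle|$. $\|u\|_q^q=\sum_j|u_j|^q$. For a vector $x$, $x_{[s]}$ denotes the vector keeping the $s$ largest entries of $x$ in magnitude and setting the rest to zero. *)

theory Defs
  imports "HOL-Probability.Probability"
begin

text \<open>Vectors in R^k are represented as functions nat => real, of which only the
entries with index < k matter. A matrix D in R^(n x d) is a function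
nat => nat => real, entry (i,j) being D i j, i < n, j < d.\<close>

definition analysis_op :: "nat \<Rightarrow> (nat \<Rightarrow> nat \<Rightarrow> real) \<Rightarrow> (nat \<Rightarrow> real) \<Rightarrow> (nat \<Rightarrow> real)" where
  "analysis_op n D f = (\<lambda>j. \<Sum>i<n. D i j * f i)"

definition mat_vec :: "nat \<Rightarrow> (nat \<times> nat \<Rightarrow> real) \<Rightarrow> (nat \<Rightarrow> real) \<Rightarrow> (nat \<Rightarrow> real)" where
  "mat_vec n A f = (\<lambda>i. \<Sum>k<n. A (i, k) * f k)"

definition l2norm :: "nat \<Rightarrow> (nat \<Rightarrow> real) \<Rightarrow> real" where
  "l2norm k x = sqrt (\<Sum>i<k. (x i)\<^sup>2)"

definition lq_q :: "real \<Rightarrow> nat \<Rightarrow> (nat \<Rightarrow> real) \<Rightarrow> real" where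
  "lq_q q k u = (\<Sum>j<k. \<bar>u j\<bar> powr q)"

definition tight_frame :: "nat \<Rightarrow> nat \<Rightarrow> (nat \<Rightarrow> nat \<Rightarrow> real) \<Rightarrow> bool" where
  "tight_frame n d D \<longleftrightarrow>
     (\<forall>f. (\<Sum>j<d. (analysis_op n D f j)\<^sup>2) = (\<Sum>i<n. (f i)\<^sup>2))"

definition mutual_coherence ::
  "nat \<Rightarrow> nat \<Rightarrow> nat \<Rightarrow> (nat \<Rightarrow> nat \<Rightarrow> real) \<Rightarrow> (nat \<Rightarrow> nat \<Rightarrow> real) \<Rightarrow> real" where
  "mutual_coherence n d1 d2 D1 D2 =
     Max ((\<lambda>(i, j). \<bar>\<Sum>k<n. D1 k i * D2 k j\<bar>) ` ({..<d1} \<times> {..<d2}))"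

definition top_set :: "nat \<Rightarrow> nat \<Rightarrow> (nat \<Rightarrow> real) \<Rightarrow> nat set \<Rightarrow> bool" where
  "top_set d s x S \<longleftrightarrow> S \<subseteq> {..<d} \<and> card S = min s d \<and>
     (\<forall>j\<in>S. \<forall>k\<in>{..<d} - S. \<bar>x k\<bar> \<le> \<bar>x j\<bar>)"

definition best_s_term :: "nat \<Rightarrow> nat \<Rightarrow> (nat \<Rightarrow> real) \<Rightarrow> (nat \<Rightarrow> real)" where
  "best_s_term d s x = (let S = (SOME S. top_set d s x S) in (\<lambda>j. if j \<in> S then x j else 0))"

definition gauss_matrix :: "nat \<Rightarrow> nat \<Rightarrow> real \<Rightarrow> (nat \<times> nat \<Rightarrow> real) measure" where
  "gauss_matrix m n \<sigma> = PiM ({..<m} \<times> {..<n}) (\<lambda>_. density lborel (normal_density 0 \<sigma>))"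

definition is_lq_solution ::
  "real \<Rightarrow> nat \<Rightarrow> nat \<Rightarrow> nat \<Rightarrow> nat \<Rightarrow> (nat \<times> nat \<Rightarrow> real) \<Rightarrow>
   (nat \<Rightarrow> nat \<Rightarrow> real) \<Rightarrow> (nat \<Rightarrow> nat \<Rightarrow> real) \<Rightarrow> (nat \<Rightarrow> real) \<Rightarrow>
   (nat \<Rightarrow> real) \<Rightarrow> (nat \<Rightarrow> real) \<Rightarrow> bool" where
  "is_lq_solution q m n d1 d2 A D1 D2 y g1 g2 \<longleftrightarrow>
     (\<forall>i<m. mat_vec n A (\<lambda>k. g1 k + g2 k) i = y i) \<and>
     (\<forall>h1 h2. (\<forall>i<m. mat_vec n A (\<lambda>k. h1 k + h2 k) i = y i) \<longrightarrow>
        lq_q q d1 (analysis_op n D1 g1) + lq_q q d2 (analysis_op n D2 g2)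
        \<le> lq_q q d1 (analysis_op n D1 h1) + lq_q q d2 (analysis_op n D2 h2))"

end

theory Submission
  imports Defs
begin

text \<open>
  Put \<open>s = s\<^sub>1 + s\<^sub>2\<close>, \<open>d = d\<^sub>1 + d\<^sub>2\<close>, let \<open>h\<^sub>i\<close> be the error of a solution and \<open>x\<close> the concatenation
  of the analysis coefficients of \<open>h\<^sub>1\<close> and \<open>h\<^sub>2\<close>. Optimality puts \<open>x\<close>, up to the best-term
  approximation error, into a cone of vectors whose lq-mass is concentrated on a set of \<open>s\<close>
  coordinates, so that \<open>\<parallel>x\<parallel>\<^sub>1 \<le> (16/5) sqrt s \<parallel>x\<parallel>\<^sub>2\<close>. The cross term of \<open>\<parallel>h\<^sub>1 + h\<^sub>2\<parallel>\<^sup>2\<close> is at most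
  the coherence times \<open>\<parallel>x\<parallel>\<^sub>1\<^sup>2 / 2\<close>, hence \<open>\<parallel>h\<^sub>1 + h\<^sub>2\<parallel> \<ge> \<parallel>x\<parallel>\<^sub>2 / 2\<close>.

  It remains to see that the Gaussian matrix does not annihilate the synthesis of a nonzero cone
  vector. Rounding a suitable multiple of \<open>x\<close> towards zero gives an integer vector of l1 norm
  \<open>O(s)\<close>; there are only \<open>exp (O(s ln (d/s)))\<close> of these, so with large probability the matrix
  distorts the norms of all their syntheses by at most a constant factor. The rounding error is
  controlled by the sup and l1 norms of the remainder, via sparse vectors. As the constant in the
  conclusion may depend on everything but the signals, the case where the approximation error
  dominates the mass of \<open>x\<close> on the \<open>s\<close> coordinates is immediate.
\<close>

section \<open>Integer vectors of bounded l1 norm\<close>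

text \<open>The subtracted term closes the induction: enlarging the range adds two copies of
  \<open>x ^ Suc k\<close>, and since x is at most 1/2 the subtracted term shrinks by at least as
  much.\<close>

lemma sum_power_abs_le:
  fixes x :: real
  assumes "0 \<le> x" "x \<le> 1/2"
  shows "(\<Sum>a\<in>{- int k..int k}. x ^ nat \<bar>a\<bar>) \<le> 1 + 4 * x - 4 * x ^ Suc k"
proof (induction k)
  case (Suc k)
  have "{- int (Suc k)..int (Suc k)} = insert (- int (Suc k)) (insert (int (Suc k)) {- int k..int k})"
    by auto
  then have "(\<Sum>a\<in>{- int (Suc k)..int (Suc k)}. x ^ nat \<bar>a\<bar>) = 2 * x ^ Suc k + (\<Sum>a\<in>{- int k..int k}. x ^ nat \<bar>a\<bar>)"
    by (simp add: nat_add_distrib)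
  moreover have "x ^ Suc (Suc k) \<le> 1/2 * x ^ Suc k"
    using mult_right_mono[of x "1/2" "x ^ Suc k"] assms by simp
  ultimately show ?case using Suc.IH by linarith
qed simp

text \<open>Functions are extensional, so a vector on d coordinates is represented once; the box
  range places the net in a finite product over which weights factorise.\<close>

definition int_net :: "nat \<Rightarrow> nat \<Rightarrow> (nat \<Rightarrow> int) set" where
  "int_net d K = {z \<in> {..<d} \<rightarrow>\<^sub>E {- int K..int K}. (\<Sum>j<d. \<bar>z j\<bar>) \<le> int K}"

lemma finite_int_net: "finite (int_net d K)"
  unfolding int_net_def by (rule finite_subset[of _ "{..<d} \<rightarrow>\<^sub>E {- int K..int K}"]) (auto intro: finite_PiE)

lemma restrict_mem_int_net:
  assumes "(\<Sum>j<d. \<bar>z j\<bar>) \<le> int K"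
  shows "restrict z {..<d} \<in> int_net d K"
proof -
  have "\<bar>z j\<bar> \<le> int K" if "j < d" for j
    using member_le_sum[of j "{..<d}" "\<lambda>j. \<bar>z j\<bar>"] that assms by simp
  then show ?thesis using assms by (force simp: int_net_def abs_le_iff)
qed

text \<open>Generating function argument: a net point of l1 norm k gets weight \<open>x ^ k\<close>,
  which is at least \<open>x ^ K\<close>, and the total weight of the surrounding box is a product
  of d geometric sums, each at most \<open>exp (4 * x)\<close>.\<close>

lemma card_int_net_le:
  fixes x :: real
  assumes "0 < x" "x \<le> 1/2"
  shows "real (card (int_net d K)) \<le> (1 / x) ^ K * exp (4 * x * real d)"
proof -
  have "real (card (int_net d K)) * x ^ K = (\<Sum>z\<in>int_net d K. x ^ K)" by simp
  also have "\<dots> \<le> (\<Sum>z\<in>int_net d K. \<Prod>j<d. x ^ nat \<bar>z j\<bar>)"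
  proof (rule sum_mono)
    fix z assume z: "z \<in> int_net d K"
    have "int (\<Sum>j<d. nat \<bar>z j\<bar>) = (\<Sum>j<d. \<bar>z j\<bar>)"
      by simp
    also have "\<dots> \<le> int K" using z by (auto simp: int_net_def)
    finally have "(\<Sum>j<d. nat \<bar>z j\<bar>) \<le> K" by (rule of_nat_le_iff[THEN iffD1])
    then show "x ^ K \<le> (\<Prod>j<d. x ^ nat \<bar>z j\<bar>)"
      using assms by (auto simp flip: power_sum intro!: power_decreasing)
  qed
  also have "\<dots> \<le> (\<Sum>z\<in>{..<d} \<rightarrow>\<^sub>E {- int K..int K}. \<Prod>j<d. x ^ nat \<bar>z j\<bar>)"
  proof (rule sum_mono2)
    show "finite ({..<d} \<rightarrow>\<^sub>E {- int K..int K})" by (simp add: finite_PiE)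
    show "int_net d K \<subseteq> {..<d} \<rightarrow>\<^sub>E {- int K..int K}" by (auto simp: int_net_def)
  qed (use assms in \<open>simp add: prod_nonneg\<close>)
  also have "\<dots> = (\<Prod>j<d. \<Sum>a\<in>{- int K..int K}. x ^ nat \<bar>a\<bar>)"
    by (subst prod_sum_PiE) auto
  also have "\<dots> \<le> (\<Prod>j<d. exp (4 * x))"
  proof (rule prod_mono)
    have "(\<Sum>a\<in>{- int K..int K}. x ^ nat \<bar>a\<bar>) \<le> 1 + 4 * x"
      using sum_power_abs_le[of x K] assms by (smt (verit) zero_le_power)
    also have "\<dots> \<le> exp (4 * x)" by (rule exp_ge_add_one_self)
    finally show "0 \<le> (\<Sum>a\<in>{- int K..int K}. x ^ nat \<bar>a\<bar>) \<and> (\<Sum>a\<in>{- int K..int K}. x ^ nat \<bar>a\<bar>) \<le> exp (4 * x)"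
      using assms by (auto intro!: sum_nonneg)
  qed
  also have "\<dots> = exp (4 * x * real d)" by (simp flip: exp_of_nat_mult add: mult_ac)
  finally show ?thesis using assms by (simp add: field_simps power_divide)
qed

section \<open>Seminorms controlled on integer vectors\<close>

lemma ex_largest_subset:
  fixes f :: "'a \<Rightarrow> 'b::linorder"
  assumes "finite A" "k \<le> card A"
  shows "\<exists>S\<subseteq>A. card S = k \<and> (\<forall>i\<in>S. \<forall>j\<in>A - S. f j \<le> f i)"
  using assms(2)
proof (induction k)
  case 0
  then show ?case by (intro exI[of _ "{}"]) auto
next
  case (Suc k)
  then obtain S where S: "S \<subseteq> A" "card S = k" "\<forall>i\<in>S. \<forall>j\<in>A - S. f j \<le> f i" by auto
  have fin: "finite (A - S)" "finite S" using assms S finite_subset by auto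
  have ne: "A - S \<noteq> {}" using S Suc.prems by auto
  then obtain a where a: "a \<in> A - S" "f a = Max (f ` (A - S))"
    using fin Max_in[of "f ` (A - S)"] by (metis finite_imageI image_iff image_is_empty)
  then have "\<forall>j\<in>A - S. f j \<le> f a" using fin by simp
  then show ?case using S a fin
    by (intro exI[of _ "insert a S"]) auto
qed

section \<open>Euclidean norms and rounding towards zero\<close>

lemma L2_set_scale: "L2_set (\<lambda>i. c * f i) A = \<bar>c\<bar> * L2_set f A"
  by (simp add: L2_set_def power_mult_distrib real_sqrt_mult flip: sum_distrib_left)

lemma L2_set_le_of_abs_le:
  assumes "\<And>i. i \<in> A \<Longrightarrow> \<bar>f i\<bar> \<le> \<bar>g i\<bar>"
  shows "L2_set f A \<le> L2_set g A"
  unfolding L2_set_def using assms by (auto intro!: sum_mono simp: abs_le_square_iff)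

text \<open>Rounding towards zero keeps both the rounded value and the remainder at most the
  argument in modulus; in particular zero entries stay zero, so sparsity is inherited.\<close>

definition trunc :: "real \<Rightarrow> int" where
  "trunc x = (if x \<ge> 0 then \<lfloor>x\<rfloor> else \<lceil>x\<rceil>)"

lemma abs_trunc_le: "\<bar>real_of_int (trunc x)\<bar> \<le> \<bar>x\<bar>"
proof (cases "x \<ge> 0")
  case False
  then have "\<lceil>x\<rceil> \<le> 0" by simp
  then show ?thesis using False le_of_int_ceiling[of x] by (simp add: trunc_def)
qed (simp add: trunc_def)

lemma abs_diff_trunc_le: "\<bar>x - trunc x\<bar> \<le> \<bar>x\<bar>"
proof (cases "x \<ge> 0")
  case False
  then have "\<lceil>x\<rceil> \<le> 0" by simp
  then have "real_of_int \<lceil>x\<rceil> \<le> 0" by linarith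
  then show ?thesis using False le_of_int_ceiling[of x] by (simp add: trunc_def)
next
  case True
  then have "0 \<le> real_of_int \<lfloor>x\<rfloor>" by simp
  then show ?thesis using True of_int_floor_le[of x] by (simp add: trunc_def)
qed

lemma abs_diff_trunc_le_1: "\<bar>x - trunc x\<bar> \<le> 1"
  unfolding trunc_def by (cases "x \<ge> 0") (simp; linarith)+

text \<open>An integer is at most its square in modulus. Hence the squared Euclidean norm of a
  vector bounds the l1 norm of its rounding, which decides membership in the net.\<close>

lemma abs_trunc_le_square: "real_of_int \<bar>trunc x\<bar> \<le> x\<^sup>2"
proof (cases "trunc x = 0")
  case False
  then have "1 \<le> \<bar>real_of_int (trunc x)\<bar>" by linarith
  then have "\<bar>real_of_int (trunc x)\<bar> \<le> \<bar>real_of_int (trunc x)\<bar> * \<bar>real_of_int (trunc x)\<bar>"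
    by (metis abs_ge_zero mult_left_mono mult.right_neutral)
  also have "\<dots> \<le> \<bar>x\<bar> * \<bar>x\<bar>" by (intro mult_mono abs_trunc_le) auto
  finally show ?thesis by (simp add: power2_eq_square)
qed simp

text \<open>Meant for \<open>p x\<close> the norm of the measured synthesis of x. The bound in
  \<open>bounded\<close> has no prescribed size: it is the starting value of the iteration in
  \<open>sparse_bound\<close>.\<close>

locale seminorm_on_coords =
  fixes d :: nat and p :: "(nat \<Rightarrow> real) \<Rightarrow> real"
  assumes tri: "p (\<lambda>j. x j + y j) \<le> p x + p y"
    and scale: "p (\<lambda>j. c * x j) = \<bar>c\<bar> * p x"
    and bounded: "\<exists>B. \<forall>x. p x \<le> B * L2_set x {..<d}"
begin

text \<open>Each pass through the net halves the excess of the operator bound over \<open>2 * a\<close>, because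
  the rounding error of a sparse vector is itself sparse.\<close>

lemma sparse_bound:
  assumes "0 < L" "4 * L \<le> K"
    and net: "\<And>z :: nat \<Rightarrow> int. (\<Sum>j<d. \<bar>z j\<bar>) \<le> int K \<Longrightarrow> p (\<lambda>j. real_of_int (z j)) \<le> a * L2_set (\<lambda>j. real_of_int (z j)) {..<d}"
    and "0 \<le> a"
    and x: "card {j. j < d \<and> x j \<noteq> 0} \<le> L"
  shows "p x \<le> 2 * a * L2_set x {..<d}"
proof -
  obtain B where B: "\<And>x. p x \<le> B * L2_set x {..<d}" using bounded by auto
  have step: "p x \<le> (2 * a + \<bar>B\<bar> / 2 ^ k) * L2_set x {..<d}" if "card {j. j < d \<and> x j \<noteq> 0} \<le> L" for x k
    using that
  proof (induction k arbitrary: x)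
    case 0
    have "p x \<le> B * L2_set x {..<d}" by (rule B)
    also have "\<dots> \<le> (2 * a + \<bar>B\<bar>) * L2_set x {..<d}"
      using assms by (intro mult_right_mono) auto
    finally show ?case by simp
  next
    case (Suc k)
    show ?case
    proof (cases "L2_set x {..<d} = 0")
      case True
      then show ?thesis using B[of x] by simp
    next
      case False
      then have pos: "L2_set x {..<d} > 0" by (simp add: less_le)
      \<comment> \<open>At norm \<open>2 * sqrt L\<close> the rounding has l1 norm at most
        \<open>4 * L\<close> and so lies in the net, while the remainder, with at most L nonzero
        entries of modulus at most 1, has half that norm.\<close>
      define c where "c = 2 * sqrt L / L2_set x {..<d}"
      have c: "c > 0" using pos assms by (simp add: c_def)
      define z where "z j = trunc (c * x j)" for j
      define r where "r j = c * x j - z j" for j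
      have cx: "L2_set (\<lambda>j. c * x j) {..<d} = 2 * sqrt L"
        using c pos unfolding L2_set_scale by (simp add: c_def)
      have "real_of_int (\<Sum>j<d. \<bar>z j\<bar>) \<le> (\<Sum>j<d. (c * x j)\<^sup>2)"
        unfolding of_int_sum z_def by (intro sum_mono abs_trunc_le_square)
      also have "\<dots> = (L2_set (\<lambda>j. c * x j) {..<d})\<^sup>2" by (simp add: L2_set_def sum_nonneg)
      also have "\<dots> = 4 * L" unfolding cx by simp
      finally have z: "(\<Sum>j<d. \<bar>z j\<bar>) \<le> int K" using assms by linarith
      have zn: "L2_set (\<lambda>j. real_of_int (z j)) {..<d} \<le> 2 * sqrt L"
        unfolding cx[symmetric] z_def by (intro L2_set_le_of_abs_le abs_trunc_le)
      have sub: "{j. j < d \<and> r j \<noteq> 0} \<subseteq> {j. j < d \<and> x j \<noteq> 0}"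
        by (auto simp: r_def z_def trunc_def)
      then have rs: "card {j. j < d \<and> r j \<noteq> 0} \<le> L"
        using Suc.prems card_mono[OF _ sub] by simp
      have "(\<Sum>j<d. (r j)\<^sup>2) = (\<Sum>j\<in>{j. j < d \<and> r j \<noteq> 0}. (r j)\<^sup>2)"
        by (intro sum.mono_neutral_right) auto
      also have "\<dots> \<le> real (card {j. j < d \<and> r j \<noteq> 0}) * 1"
        unfolding r_def z_def
        by (intro sum_bounded_above) (use abs_diff_trunc_le_1 abs_square_le_1 in auto)
      finally have rn: "L2_set r {..<d} \<le> sqrt L"
        unfolding L2_set_def using rs by simp
      have "c * p x = p (\<lambda>j. c * x j)" using c by (simp add: scale)
      also have "\<dots> = p (\<lambda>j. real_of_int (z j) + r j)" by (simp add: r_def)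
      also have "\<dots> \<le> p (\<lambda>j. real_of_int (z j)) + p r" by (rule tri)
      also have "\<dots> \<le> a * L2_set (\<lambda>j. real_of_int (z j)) {..<d} + (2 * a + \<bar>B\<bar> / 2 ^ k) * L2_set r {..<d}"
        by (intro add_mono net z Suc.IH rs)
      also have "\<dots> \<le> a * (2 * sqrt L) + (2 * a + \<bar>B\<bar> / 2 ^ k) * sqrt L"
        using assms by (intro add_mono mult_left_mono zn rn) auto
      also have "\<dots> = c * ((2 * a + \<bar>B\<bar> / 2 ^ Suc k) * L2_set x {..<d})"
        using pos by (simp add: c_def field_simps)
      finally show ?thesis using c by simp
    qed
  qed
  \<comment> \<open>Letting the number of passes tend to infinity removes the excess over
    \<open>2 * a\<close>.\<close>
  have "(\<lambda>k. (2 * a + \<bar>B\<bar> / 2 ^ k) * L2_set x {..<d}) \<longlonglongrightarrow> (2 * a + 0) * L2_set x {..<d}"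
    by (intro tendsto_intros LIMSEQ_divide_realpow_zero) auto
  then have "p x \<le> (2 * a + 0) * L2_set x {..<d}"
    by (rule LIMSEQ_le_const) (use step[OF x] in auto)
  then show ?thesis by simp
qed

text \<open>Peeling off the \<open>L\<close> largest entries: those of the remainder are at most the average of the
  peeled ones, which turns the sup norm of the remainder into a share of the l1 norm.\<close>

lemma flat_bound:
  assumes "0 < L" "0 \<le> u"
    and sparse: "\<And>x. card {j. j < d \<and> x j \<noteq> 0} \<le> L \<Longrightarrow> p x \<le> u * L2_set x {..<d}"
    and "\<And>j. j < d \<Longrightarrow> \<bar>x j\<bar> \<le> b" "0 \<le> b"
  shows "p x \<le> u * (sqrt L * b + (\<Sum>j<d. \<bar>x j\<bar>) / sqrt L)"
  using assms(4,5)
proof (induction "card {j. j < d \<and> x j \<noteq> 0}" arbitrary: x b rule: less_induct)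
  case less
  let ?A = "{j. j < d \<and> x j \<noteq> 0}"
  have small: "L2_set y {..<d} \<le> sqrt L * b"
    if y: "card {j. j < d \<and> y j \<noteq> 0} \<le> L" "\<And>j. j < d \<Longrightarrow> \<bar>y j\<bar> \<le> b" for y
  proof -
    have "(\<Sum>j<d. (y j)\<^sup>2) = (\<Sum>j\<in>{j. j < d \<and> y j \<noteq> 0}. (y j)\<^sup>2)"
      by (intro sum.mono_neutral_right) auto
    also have "\<dots> \<le> real (card {j. j < d \<and> y j \<noteq> 0}) * b\<^sup>2"
      by (intro sum_bounded_above) (use y less.prems in \<open>auto simp: abs_le_square_iff[symmetric]\<close>)
    also have "\<dots> \<le> real L * b\<^sup>2" using y by (intro mult_right_mono) auto
    finally show ?thesis
      unfolding L2_set_def using less.prems by (metis real_sqrt_le_iff real_sqrt_mult real_sqrt_abs abs_of_nonneg)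
  qed
  show ?case
  proof (cases "card ?A \<le> L")
    case True
    have "p x \<le> u * L2_set x {..<d}" by (rule sparse[OF True])
    also have "\<dots> \<le> u * (sqrt L * b + (\<Sum>j<d. \<bar>x j\<bar>) / sqrt L)"
      using small[OF True less.prems(1)] assms
      by (intro mult_left_mono add_increasing2) (auto intro!: sum_nonneg divide_nonneg_nonneg)
    finally show ?thesis .
  next
    case False
    then obtain S where S: "S \<subseteq> ?A" "card S = L" "\<forall>i\<in>S. \<forall>j\<in>?A - S. \<bar>x j\<bar> \<le> \<bar>x i\<bar>"
      using ex_largest_subset[of ?A L "\<lambda>j. \<bar>x j\<bar>"] by auto
    have finS: "finite S" using S assms card_ge_0_finite by auto
    define y where "y j = (if j \<in> S then x j else 0)" for j
    define w where "w j = (if j \<in> S then 0 else x j)" for j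
    have ysupp: "{j. j < d \<and> y j \<noteq> 0} = S" using S by (auto simp: y_def)
    have wsupp: "{j. j < d \<and> w j \<noteq> 0} = ?A - S" by (auto simp: w_def)
    define e where "e = (\<Sum>j\<in>S. \<bar>x j\<bar>) / L"
    have e: "0 \<le> e" by (simp add: e_def sum_nonneg)
    have "\<bar>w j\<bar> \<le> e" if "j < d" for j
    proof (cases "j \<in> ?A - S")
      case True
      then have "real (card S) * \<bar>x j\<bar> \<le> (\<Sum>i\<in>S. \<bar>x i\<bar>)"
        using S by (intro sum_bounded_below) auto
      then show ?thesis using S assms True by (simp add: e_def w_def field_simps)
    next
      case False
      then show ?thesis using that e by (auto simp: w_def)
    qed
    moreover have "card {j. j < d \<and> w j \<noteq> 0} < card ?A"
    proof -
      have "S \<noteq> {}" using S assms by auto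
      then show ?thesis
        unfolding wsupp using S by (intro psubset_card_mono) (simp, blast)
    qed
    ultimately have pw: "p w \<le> u * (sqrt L * e + (\<Sum>j<d. \<bar>w j\<bar>) / sqrt L)"
      using less.hyps e by blast
    have py: "p y \<le> u * (sqrt L * b)"
    proof -
      have "p y \<le> u * L2_set y {..<d}" using S ysupp by (intro sparse) simp
      also have "\<dots> \<le> u * (sqrt L * b)"
        using S ysupp less.prems assms by (intro mult_left_mono small) (auto simp: y_def)
      finally show ?thesis .
    qed
    have split: "(\<Sum>j<d. \<bar>x j\<bar>) = (\<Sum>j\<in>S. \<bar>x j\<bar>) + (\<Sum>j<d. \<bar>w j\<bar>)"
    proof -
      have "(\<Sum>j<d. \<bar>x j\<bar>) = (\<Sum>j<d. \<bar>y j\<bar> + \<bar>w j\<bar>)"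
        by (intro sum.cong) (auto simp: y_def w_def)
      also have "(\<Sum>j<d. \<bar>y j\<bar> + \<bar>w j\<bar>) = (\<Sum>j<d. \<bar>y j\<bar>) + (\<Sum>j<d. \<bar>w j\<bar>)"
        by (rule sum.distrib)
      also have "(\<Sum>j<d. \<bar>y j\<bar>) = (\<Sum>j\<in>S. \<bar>x j\<bar>)"
        using S by (intro sum.mono_neutral_cong_right) (auto simp: y_def)
      finally show ?thesis .
    qed
    \<comment> \<open>The sup norm term of the remainder equals the l1 share of the peeled block, so
      the recursion adds up to the full l1 norm and only the first block pays
      \<open>sqrt L * b\<close>.\<close>
    have "sqrt L * e = (\<Sum>j\<in>S. \<bar>x j\<bar>) / sqrt L"
      using assms by (simp add: e_def field_simps)
    then have "sqrt L * e + (\<Sum>j<d. \<bar>w j\<bar>) / sqrt L = (\<Sum>j<d. \<bar>x j\<bar>) / sqrt L"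
      by (simp add: split add_divide_distrib)
    then have pw': "p w \<le> u * ((\<Sum>j<d. \<bar>x j\<bar>) / sqrt L)" using pw by simp
    have "x = (\<lambda>j. y j + w j)" by (auto simp: y_def w_def)
    then have "p x \<le> p y + p w" using tri[of y w] by simp
    then show ?thesis using py pw' by (simp add: distrib_left)
  qed
qed

text \<open>At the scale \<open>10 ^ 6\<close> the rounded vector contributes at least \<open>490000 / 3 * B * sqrt s\<close>, which
  beats the contribution \<open>9 * 4200 * B * sqrt s\<close> of the rounding error.\<close>

lemma pos_of_net:
  assumes "0 < s" "0 < B"
    and Ntri: "\<And>x y. N (\<lambda>j. x j + y j) \<le> N x + N y"
    and Nscale: "\<And>c x. N (\<lambda>j. c * x j) = \<bar>c\<bar> * N x"
    and Nle: "\<And>x. N x \<le> 3/2 * L2_set x {..<d}"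
    and net: "\<And>z :: nat \<Rightarrow> int. (\<Sum>j<d. \<bar>z j\<bar>) \<le> int (10 ^ 12 * s) \<Longrightarrow>
        B / 3 * N (\<lambda>j. real_of_int (z j)) \<le> p (\<lambda>j. real_of_int (z j)) \<and> p (\<lambda>j. real_of_int (z j)) \<le> 3 * B * N (\<lambda>j. real_of_int (z j))"
    and x2: "(\<Sum>j<d. (x j)\<^sup>2) = real s" and x1: "(\<Sum>j<d. \<bar>x j\<bar>) \<le> 16/5 * real s"
    and Nx: "N x \<ge> 1/2 * sqrt s"
  shows "p x > 0"
proof -
  \<comment> \<open>With this sparsity \<open>4 * L\<close> fits into the net radius, and both terms
    of \<open>flat_bound\<close> stay at a few thousand times \<open>sqrt s\<close> for a remainder
    of sup norm 1 and l1 norm at most \<open>3200000 * s\<close>.\<close>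
  define L where "L = 10 ^ 6 * s"
  have sL: "sqrt L = 1000 * sqrt s"
    by (simp add: L_def real_sqrt_mult)
  have L: "0 < L" "4 * L \<le> 10 ^ 12 * s" using assms by (auto simp: L_def)
  have sparse: "p y \<le> 9 * B * L2_set y {..<d}" if "card {j. j < d \<and> y j \<noteq> 0} \<le> L" for y
  proof -
    have "p (\<lambda>j. real_of_int (z j)) \<le> (9/2 * B) * L2_set (\<lambda>j. real_of_int (z j)) {..<d}"
      if "(\<Sum>j<d. \<bar>z j\<bar>) \<le> int (10 ^ 12 * s)" for z :: "nat \<Rightarrow> int"
    proof -
      have "p (\<lambda>j. real_of_int (z j)) \<le> 3 * B * N (\<lambda>j. real_of_int (z j))" using net[OF that] by simp
      also have "\<dots> \<le> 3 * B * (3/2 * L2_set (\<lambda>j. real_of_int (z j)) {..<d})"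
        using assms by (intro mult_left_mono Nle) auto
      finally show ?thesis by simp
    qed
    from sparse_bound[OF L this _ that] assms show ?thesis by simp
  qed
  define z where "z j = trunc (1000000 * x j)" for j
  define r where "r j = 1000000 * x j - z j" for j
  have "real_of_int (\<Sum>j<d. \<bar>z j\<bar>) \<le> (\<Sum>j<d. (1000000 * x j)\<^sup>2)"
    unfolding of_int_sum z_def by (intro sum_mono abs_trunc_le_square)
  also have "\<dots> = 10 ^ 12 * s"
    by (simp add: power_mult_distrib x2 flip: sum_distrib_left)
  finally have "real_of_int (\<Sum>j<d. \<bar>z j\<bar>) \<le> real_of_int (int (10 ^ 12 * s))" by simp
  then have z: "(\<Sum>j<d. \<bar>z j\<bar>) \<le> int (10 ^ 12 * s)" by (rule of_int_le_iff[THEN iffD1])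
  have r1: "\<bar>r j\<bar> \<le> 1" for j unfolding r_def z_def by (rule abs_diff_trunc_le_1)
  have rx: "(\<Sum>j<d. \<bar>r j\<bar>) \<le> 1000000 * (16/5 * s)"
  proof -
    have "(\<Sum>j<d. \<bar>r j\<bar>) \<le> (\<Sum>j<d. \<bar>1000000 * x j\<bar>)"
      unfolding r_def z_def by (intro sum_mono abs_diff_trunc_le)
    also have "\<dots> = 1000000 * (\<Sum>j<d. \<bar>x j\<bar>)" by (simp add: abs_mult sum_distrib_left)
    finally show ?thesis using x1 by linarith
  qed
  \<comment> \<open>Entries of modulus at most 1 have squares at most their moduli, so the squared
    norm is at most \<open>3200000 * s\<close>, below
    \<open>(2000 * sqrt s)\<^sup>2\<close>.\<close>
  have "L2_set r {..<d} \<le> 2000 * sqrt s"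
    unfolding L2_set_def
  proof (rule real_le_lsqrt)
    have "(\<Sum>j<d. (r j)\<^sup>2) \<le> (\<Sum>j<d. \<bar>r j\<bar>)"
    proof (rule sum_mono)
      fix j show "(r j)\<^sup>2 \<le> \<bar>r j\<bar>"
        using mult_left_mono[OF r1[of j] abs_ge_zero[of "r j"]]
        unfolding abs_mult_self_eq mult_1_right power2_eq_square .
    qed
    also have "\<dots> \<le> (2000 * sqrt s)\<^sup>2" using rx by (simp add: power_mult_distrib)
    finally show "(\<Sum>j<d. (r j)\<^sup>2) \<le> (2000 * sqrt s)\<^sup>2" .
    show "0 \<le> 2000 * sqrt s" by simp
  qed
  then have "N r \<le> 3000 * sqrt s" using Nle[of r] by simp
  moreover have "1000000 * N x \<le> N (\<lambda>j. real_of_int (z j)) + N r"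
    using Nscale[of "1000000" x] Ntri[of "\<lambda>j. real_of_int (z j)" r] by (simp add: r_def)
  moreover have "0 \<le> sqrt s" by simp
  \<comment> \<open>The scaled lower bound \<open>500000 * sqrt s\<close> loses at most
    \<open>3000 * sqrt s\<close> to the remainder.\<close>
  ultimately have "N (\<lambda>j. real_of_int (z j)) \<ge> 490000 * sqrt s"
    using Nx by linarith
  then have "B / 3 * (490000 * sqrt s) \<le> B / 3 * N (\<lambda>j. real_of_int (z j))"
    using assms by (intro mult_left_mono) auto
  also have "\<dots> \<le> p (\<lambda>j. real_of_int (z j))" using net[OF z] by simp
  finally have pz: "B / 3 * (490000 * sqrt s) \<le> p (\<lambda>j. real_of_int (z j))" .
  have "p r \<le> 9 * B * (sqrt L * 1 + (\<Sum>j<d. \<bar>r j\<bar>) / sqrt L)"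
    using L assms by (intro flat_bound sparse r1) auto
  also have "\<dots> \<le> 9 * B * (sqrt L * 1 + 1000000 * (16/5 * s) / sqrt L)"
    using rx L assms by (intro mult_left_mono add_left_mono divide_right_mono) auto
  also have "1000000 * (16/5 * s) / sqrt L = 3200 * sqrt s"
    unfolding sL using assms by (simp add: field_simps)
  finally have pr: "p r \<le> 9 * B * (4200 * sqrt s)" unfolding sL by simp
  have "p (\<lambda>j. real_of_int (z j)) \<le> p (\<lambda>j. 1000000 * x j) + p (\<lambda>j. - 1 * r j)"
    using tri[of "\<lambda>j. 1000000 * x j" "\<lambda>j. - 1 * r j"] by (simp add: r_def)
  also have "\<dots> = 1000000 * p x + p r" unfolding scale by simp
  finally have "1000000 * p x \<ge> B * sqrt s * (490000 / 3 - 37800)"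
    using pz pr by (simp add: algebra_simps)
  moreover have "B * sqrt s > 0" using assms by simp
  ultimately show ?thesis by simp
qed

end

section \<open>Gaussian matrices\<close>

text \<open>Exponential tilting by \<open>l * x\<^sup>2\<close> turns the Gaussian density of
  deviation t into u / t times the one of deviation u. Both signs of l are covered; the existence of
  a positive u expresses that the integral is finite.\<close>

lemma nn_integral_normal_exp_square:
  assumes "0 < t" "0 < u" and tu: "1 / u\<^sup>2 = 1 / t\<^sup>2 - 2 * l"
  shows "(\<integral>\<^sup>+x. ennreal (normal_density 0 t x) * ennreal (exp (l * x\<^sup>2)) \<partial>lborel) = ennreal (u / t)"
proof -
  have "normal_density 0 t x * exp (l * x\<^sup>2) = u / t * normal_density 0 u x" for x
  proof -
    have l: "l = (1 / t\<^sup>2 - 1 / u\<^sup>2) / 2" using tu by simp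
    have "- x\<^sup>2 / (2 * t\<^sup>2) + l * x\<^sup>2 = - x\<^sup>2 / (2 * u\<^sup>2)"
      unfolding l by (simp add: field_simps)
    then have "exp (- x\<^sup>2 / (2 * t\<^sup>2)) * exp (l * x\<^sup>2) = exp (- x\<^sup>2 / (2 * u\<^sup>2))"
      by (simp flip: exp_add)
    moreover have "1 / sqrt (2 * pi * t\<^sup>2) = u / t * (1 / sqrt (2 * pi * u\<^sup>2))"
      using assms by (simp add: real_sqrt_mult field_simps)
    ultimately show ?thesis
      by (simp add: normal_density_def mult.assoc)
  qed
  then have "(\<integral>\<^sup>+x. ennreal (normal_density 0 t x) * ennreal (exp (l * x\<^sup>2)) \<partial>lborel)
      = (\<integral>\<^sup>+x. ennreal (u / t) * ennreal (normal_density 0 u x) \<partial>lborel)"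
    using assms by (simp flip: ennreal_mult')
  also have "\<dots> = ennreal (u / t) * (\<integral>\<^sup>+x. ennreal (normal_density 0 u x) \<partial>lborel)"
    by (rule nn_integral_cmult) auto
  also have "(\<integral>\<^sup>+x. ennreal (normal_density 0 u x) \<partial>lborel) = 1"
    using assms by (subst nn_integral_eq_integral) (auto simp: normal_density_nonneg)
  finally show ?thesis by simp
qed

section \<open>The Gaussian matrix as a product measure: measurability, independence and law of the
  rows\<close>

lemma prob_space_gauss_matrix:
  assumes "0 < \<sigma>"
  shows "prob_space (gauss_matrix m n \<sigma>)"
  unfolding gauss_matrix_def using assms by (intro prob_space_PiM prob_space_normal_density)

lemma measurable_gauss_matrix_component [measurable (raw)]:
  assumes "i < m" "k < n"
  shows "(\<lambda>A. A (i, k)) \<in> borel_measurable (gauss_matrix m n \<sigma>)"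
proof -
  have "(\<lambda>A. A (i, k)) \<in> measurable (gauss_matrix m n \<sigma>) (density lborel (normal_density 0 \<sigma>))"
    unfolding gauss_matrix_def using assms by (intro measurable_component_singleton) auto
  then show ?thesis by simp
qed

lemma measurable_mat_vec:
  assumes "i < m"
  shows "(\<lambda>A. mat_vec n A v i) \<in> borel_measurable (gauss_matrix m n \<sigma>)"
  unfolding mat_vec_def using assms
  by (intro borel_measurable_sum borel_measurable_times measurable_gauss_matrix_component) auto

lemma measurable_L2_set_mat_vec [measurable]:
  "(\<lambda>A. L2_set (mat_vec n A v) {..<m}) \<in> borel_measurable (gauss_matrix m n \<sigma>)"
  unfolding L2_set_def
  by (intro borel_measurable_sum borel_measurable_power measurable_mat_vec
       borel_measurable_sqrt[THEN measurable_compose_rev]) auto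

lemma indep_vars_gauss_matrix:
  assumes "0 < \<sigma>" "0 < n" "0 < m"
  shows "prob_space.indep_vars (gauss_matrix m n \<sigma>) (\<lambda>_. borel) (\<lambda>ik A. A ik) ({..<m} \<times> {..<n})"
proof -
  let ?N = "density lborel (normal_density 0 \<sigma>)" and ?I = "{..<m} \<times> {..<n}"
  interpret prob_space "gauss_matrix m n \<sigma>" by (rule prob_space_gauss_matrix) fact
  have "indep_vars (\<lambda>_. ?N) (\<lambda>ik A. A ik) ?I"
  proof (subst indep_vars_iff_distr_eq_PiM')
    show "?I \<noteq> {}" using assms by auto
    show "random_variable ?N (\<lambda>A. A ik)" if "ik \<in> ?I" for ik
      using that unfolding gauss_matrix_def by (intro measurable_component_singleton)
    have "distr (gauss_matrix m n \<sigma>) (Pi\<^sub>M ?I (\<lambda>_. ?N)) (\<lambda>x. restrict x ?I)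
        = distr (gauss_matrix m n \<sigma>) (Pi\<^sub>M ?I (\<lambda>_. ?N)) (\<lambda>x. x)"
      unfolding gauss_matrix_def
      by (rule distr_cong) (auto simp: space_PiM PiE_restrict)
    also have "\<dots> = Pi\<^sub>M ?I (\<lambda>_. ?N)" by (simp add: gauss_matrix_def distr_id)
    also have "\<dots> = Pi\<^sub>M ?I (\<lambda>ik. distr (gauss_matrix m n \<sigma>) ?N (\<lambda>A. A ik))"
      unfolding gauss_matrix_def
      by (intro PiM_cong refl distr_PiM_component[symmetric] prob_space_normal_density assms)
    finally show "distr (gauss_matrix m n \<sigma>) (Pi\<^sub>M ?I (\<lambda>_. ?N)) (\<lambda>A. \<lambda>ik\<in>?I. A ik)
       = Pi\<^sub>M ?I (\<lambda>ik. distr (gauss_matrix m n \<sigma>) ?N (\<lambda>A. A ik))"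
      by simp
  qed
  from indep_vars_compose2[OF this, of "\<lambda>_ x. x" "\<lambda>_. borel"] show ?thesis by simp
qed

lemma distributed_gauss_matrix_component:
  assumes "0 < \<sigma>" "i < m" "k < n"
  shows "distributed (gauss_matrix m n \<sigma>) lborel (\<lambda>A. A (i, k)) (normal_density 0 \<sigma>)"
proof -
  have "distr (gauss_matrix m n \<sigma>) lborel (\<lambda>A. A (i, k))
      = distr (gauss_matrix m n \<sigma>) (density lborel (normal_density 0 \<sigma>)) (\<lambda>A. A (i, k))"
    by (rule distr_cong) auto
  also have "\<dots> = density lborel (normal_density 0 \<sigma>)"
    unfolding gauss_matrix_def using assms
    by (intro distr_PiM_component prob_space_normal_density) auto
  finally show ?thesis
    using measurable_gauss_matrix_component[OF assms(2,3)] by (simp add: distributed_def)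
qed

lemma distributed_gauss_mat_vec:
  assumes "0 < \<sigma>" "i < m" and v: "L2_set v {..<n} \<noteq> 0"
  shows "distributed (gauss_matrix m n \<sigma>) lborel (\<lambda>A. mat_vec n A v i)
           (normal_density 0 (\<sigma> * L2_set v {..<n}))"
proof -
  interpret prob_space "gauss_matrix m n \<sigma>" by (rule prob_space_gauss_matrix) fact
  \<comment> \<open>The sum is restricted to the support of v, because a summand with coefficient 0
    has no normal density.\<close>
  define J where "J = {k. k < n \<and> v k \<noteq> 0}"
  have J: "finite J" "J \<noteq> {}" "J \<subseteq> {..<n}"
    using v by (auto simp: J_def L2_set_eq_0_iff)
  have "n > 0" using J by (cases n) auto
  have "indep_vars (\<lambda>_. borel) (\<lambda>ik A. A ik) ({i} \<times> J)"
    using J assms \<open>n > 0\<close> by (intro indep_vars_subset[OF indep_vars_gauss_matrix]) auto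
  from indep_vars_compose2[OF this, of "\<lambda>ik x. v (snd ik) * x" "\<lambda>_. borel"]
  have ind: "indep_vars (\<lambda>_. borel) (\<lambda>ik A. v (snd ik) * A ik) ({i} \<times> J)" by simp
  have "distributed (gauss_matrix m n \<sigma>) lborel (\<lambda>A. v (snd ik) * A ik) (normal_density 0 (\<bar>v (snd ik)\<bar> * \<sigma>))"
    if "ik \<in> {i} \<times> J" for ik
    using normal_density_affine[OF distributed_gauss_matrix_component[of \<sigma> i m "snd ik" n], of "v (snd ik)" 0] that assms
    by (auto simp: J_def)
  from sum_indep_normal[OF _ _ ind _ this]
  have "distributed (gauss_matrix m n \<sigma>) lborel (\<lambda>A. \<Sum>ik\<in>{i} \<times> J. v (snd ik) * A ik)
      (normal_density 0 (sqrt (\<Sum>ik\<in>{i} \<times> J. (\<bar>v (snd ik)\<bar> * \<sigma>)\<^sup>2)))"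
    using assms J by (auto simp: J_def)
  also have "(\<lambda>A. \<Sum>ik\<in>{i} \<times> J. v (snd ik) * A ik) = (\<lambda>A. \<Sum>k\<in>J. v k * A (i, k))"
    by (intro ext sum.reindex_bij_witness[of _ "\<lambda>k. (i, k)" snd]) auto
  also have "\<dots> = (\<lambda>A. mat_vec n A v i)"
    unfolding mat_vec_def by (intro ext sum.mono_neutral_cong_left) (auto simp: J_def)
  also have "(\<Sum>ik\<in>{i} \<times> J. (\<bar>v (snd ik)\<bar> * \<sigma>)\<^sup>2) = (\<Sum>k\<in>J. (\<bar>v k\<bar> * \<sigma>)\<^sup>2)"
    by (intro sum.reindex_bij_witness[of _ "\<lambda>k. (i, k)" snd]) auto
  also have "(\<Sum>k\<in>J. (\<bar>v k\<bar> * \<sigma>)\<^sup>2) = (\<Sum>k<n. (\<bar>v k\<bar> * \<sigma>)\<^sup>2)"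
    by (intro sum.mono_neutral_left) (auto simp: J_def)
  also have "\<dots> = \<sigma>\<^sup>2 * (\<Sum>k<n. (v k)\<^sup>2)"
    by (simp add: power_mult_distrib sum_distrib_left mult.commute)
  also have "sqrt \<dots> = \<sigma> * L2_set v {..<n}"
    using assms by (simp add: real_sqrt_mult L2_set_def)
  finally show ?thesis .
qed

text \<open>The rows are independent and each contributes the tilting factor c, the ratio of the
  tilted to the original deviation. Values c > 1 give positive l and serve the upper tail, c < 1 the
  lower one.\<close>

lemma nn_integral_gauss_exp:
  assumes "0 < \<sigma>" and v: "L2_set v {..<n} \<noteq> 0" and "0 < c" "l = (1 - 1 / c\<^sup>2) / (2 * (\<sigma> * L2_set v {..<n})\<^sup>2)"
  shows "(\<integral>\<^sup>+A. ennreal (exp (l * (L2_set (mat_vec n A v) {..<m})\<^sup>2)) \<partial>gauss_matrix m n \<sigma>) = ennreal (c ^ m)"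
proof (cases "m = 0")
  case True
  interpret prob_space "gauss_matrix m n \<sigma>" by (rule prob_space_gauss_matrix) fact
  show ?thesis using True emeasure_space_1 by (simp add: True)
next
  case False
  interpret prob_space "gauss_matrix m n \<sigma>" by (rule prob_space_gauss_matrix) fact
  let ?t = "\<sigma> * L2_set v {..<n}"
  have t: "?t > 0" using assms by (simp add: less_le)
  have n: "n > 0" using v by (cases n) auto
  \<comment> \<open>Independence of the entries passes to functions of disjoint blocks; the blocks
    are the rows.\<close>
  have "indep_vars (\<lambda>i. PiM ({i} \<times> {..<n}) (\<lambda>_. borel)) (\<lambda>i A. restrict (\<lambda>ik. A ik) ({i} \<times> {..<n})) {..<m}"
    using indep_vars_restrict[OF indep_vars_gauss_matrix[of \<sigma> n m], of "{..<m}" "\<lambda>i. {i} \<times> {..<n}"] False n assms(1)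
    by (auto simp: disjoint_family_on_def)
  from indep_vars_compose2[OF this, of "\<lambda>i A. exp (l * (\<Sum>k<n. A (i, k) * v k)\<^sup>2)" "\<lambda>_. borel"]
  have "indep_vars (\<lambda>_. borel) (\<lambda>i A. exp (l * (\<Sum>k<n. restrict (\<lambda>ik. A ik) ({i} \<times> {..<n}) (i, k) * v k)\<^sup>2)) {..<m}"
    by simp
  also have "(\<lambda>i A. exp (l * (\<Sum>k<n. restrict (\<lambda>ik. A ik) ({i} \<times> {..<n}) (i, k) * v k)\<^sup>2)) 
     = (\<lambda>i A. exp (l * (mat_vec n A v i)\<^sup>2))"
    by (simp add: mat_vec_def)
  finally have ind: "indep_vars (\<lambda>_. borel) (\<lambda>i A. ennreal (exp (l * (mat_vec n A v i)\<^sup>2))) {..<m}"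
    using indep_vars_compose2[where Y="\<lambda>_. ennreal" and N="\<lambda>_. borel"] by fastforce
  have "(\<integral>\<^sup>+A. ennreal (exp (l * (L2_set (mat_vec n A v) {..<m})\<^sup>2)) \<partial>gauss_matrix m n \<sigma>)
     = (\<integral>\<^sup>+A. (\<Prod>i<m. ennreal (exp (l * (mat_vec n A v i)\<^sup>2))) \<partial>gauss_matrix m n \<sigma>)"
    by (intro nn_integral_cong) (simp add: L2_set_def sum_nonneg sum_distrib_left exp_sum prod_ennreal)
  also have "\<dots> = (\<Prod>i<m. \<integral>\<^sup>+A. ennreal (exp (l * (mat_vec n A v i)\<^sup>2)) \<partial>gauss_matrix m n \<sigma>)"
    by (rule indep_vars_nn_integral[OF _ ind]) auto
  also have "\<dots> = (\<Prod>i<m. ennreal c)"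
  proof (rule prod.cong[OF refl])
    fix i assume "i \<in> {..<m}"
    then have d: "distributed (gauss_matrix m n \<sigma>) lborel (\<lambda>A. mat_vec n A v i) (normal_density 0 ?t)"
      using distributed_gauss_mat_vec assms by auto
    have "(\<integral>\<^sup>+A. ennreal (exp (l * (mat_vec n A v i)\<^sup>2)) \<partial>gauss_matrix m n \<sigma>)
      = (\<integral>\<^sup>+x. ennreal (normal_density 0 ?t x) * ennreal (exp (l * x\<^sup>2)) \<partial>lborel)"
      by (rule distributed_nn_integral[OF d, symmetric]) auto
    also have "\<dots> = ennreal (c * ?t / ?t)"
      by (intro nn_integral_normal_exp_square t mult_pos_pos[OF \<open>0 < c\<close> t])
        (use t assms in \<open>simp add: power_mult_distrib divide_simps algebra_simps\<close>)
    finally show "(\<integral>\<^sup>+A. ennreal (exp (l * (mat_vec n A v i)\<^sup>2)) \<partial>gauss_matrix m n \<sigma>) = ennreal c"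
      using assms(1,2) by simp
  qed
  also have "\<dots> = ennreal (c ^ m)" using assms by (simp add: ennreal_power)
  finally show ?thesis .
qed

text \<open>Chernoff bounds for the squared norm. The factors 3 and 1/3 are far enough from 1 that
  each tail is at most \<open>exp (- (m / 2))\<close>.\<close>

lemma gauss_norm_concentration:
  assumes "0 < \<sigma>"
  shows "measure (gauss_matrix m n \<sigma>)
     {A \<in> space (gauss_matrix m n \<sigma>). \<not> (sqrt m * \<sigma> / 3 * L2_set v {..<n} \<le> L2_set (mat_vec n A v) {..<m}
        \<and> L2_set (mat_vec n A v) {..<m} \<le> 3 * sqrt m * \<sigma> * L2_set v {..<n})} \<le> 2 * exp (- (real m / 2))"
proof (cases "L2_set v {..<n} = 0")
  case True
  then have "mat_vec n A v i = 0" for A i by (auto simp: mat_vec_def L2_set_eq_0_iff)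
  then have "L2_set (mat_vec n A v) {..<m} = 0" for A by (simp add: L2_set_eq_0_iff)
  then show ?thesis using True by simp
next
  case False
  let ?M = "gauss_matrix m n \<sigma>"
  interpret prob_space ?M by (rule prob_space_gauss_matrix) fact
  define t where "t = \<sigma> * L2_set v {..<n}"
  have t: "t > 0" using assms False by (simp add: less_le t_def)
  define W where "W A = (L2_set (mat_vec n A v) {..<m})\<^sup>2" for A
  have [measurable]: "W \<in> borel_measurable ?M"
    unfolding W_def by measurable
  \<comment> \<open>One Markov estimate for both tails: the sign of l decides which side of W is
    bounded.\<close>
  have tail: "measure ?M {A \<in> space ?M. b \<le> l * W A} \<le> c ^ m / exp b"
    if "0 < c" "l = (1 - 1 / c\<^sup>2) / (2 * t\<^sup>2)" for c l b
  proof -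
    have "emeasure ?M {A \<in> space ?M. 1 \<le> ennreal (exp (-b)) * ennreal (exp (l * W A))}
      \<le> ennreal (exp (-b)) * (\<integral>\<^sup>+A. ennreal (exp (l * W A)) * indicator (space ?M) A \<partial>?M)"
      by (rule nn_integral_Markov_inequality) auto
    also have "(\<integral>\<^sup>+A. ennreal (exp (l * W A)) * indicator (space ?M) A \<partial>?M) = (\<integral>\<^sup>+A. ennreal (exp (l * W A)) \<partial>?M)"
      by (intro nn_integral_cong) auto
    also have "\<dots> = ennreal (c ^ m)"
      unfolding W_def using that assms False by (intro nn_integral_gauss_exp) (auto simp: t_def)
    also have "{A \<in> space ?M. 1 \<le> ennreal (exp (-b)) * ennreal (exp (l * W A))} = {A \<in> space ?M. b \<le> l * W A}"
      by (auto simp flip: ennreal_mult exp_add)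
    finally have "ennreal (measure ?M {A \<in> space ?M. b \<le> l * W A}) \<le> ennreal (exp (-b) * c ^ m)"
      using that by (simp only: emeasure_eq_measure ennreal_mult zero_le_power less_imp_le exp_ge_zero)
    then show ?thesis using that by (simp add: exp_minus field_simps)
  qed
  have e3: "exp 1 \<le> (3::real)" by (rule exp_le)
  \<comment> \<open>Tilting with c = 2; after division by l the event is W at least
    \<open>9 * m * t\<^sup>2\<close>.\<close>
  have up: "measure ?M {A \<in> space ?M. 27/8 * m \<le> 3 / (8 * t\<^sup>2) * W A} \<le> exp (- (real m / 2))"
  proof -
    have "measure ?M {A \<in> space ?M. 27/8 * m \<le> 3 / (8 * t\<^sup>2) * W A} \<le> 2 ^ m / exp (27/8 * m)"
      using t by (intro tail) (auto simp: field_simps)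
    also have "\<dots> \<le> exp (real m) / exp (27/8 * m)"
    proof -
      have "2 \<le> exp (1::real)" using exp_ge_add_one_self[of 1] by simp
      then have "2 ^ m \<le> exp (1::real) ^ m" by (intro power_mono) auto
      then show ?thesis by (intro divide_right_mono) (auto simp flip: exp_of_nat_mult)
    qed
    also have "\<dots> \<le> exp (- (real m / 2))" by (auto simp flip: exp_diff)
    finally show ?thesis .
  qed
  \<comment> \<open>Tilting with c = 1/3; l is negative, so the event is W at most
    \<open>m * t\<^sup>2 / 9\<close>.\<close>
  have low: "measure ?M {A \<in> space ?M. - (4/9 * m) \<le> - (4 / t\<^sup>2) * W A} \<le> exp (- (real m / 2))"
  proof -
    have "measure ?M {A \<in> space ?M. - (4/9 * m) \<le> - (4 / t\<^sup>2) * W A} \<le> (1/3) ^ m / exp (- (4/9 * m))"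
      using t by (intro tail) (auto simp: field_simps power2_eq_square)
    also have "\<dots> \<le> exp (- real m) / exp (- (4/9 * m))"
    proof -
      have "1/3 \<le> exp (-1::real)" using e3 by (simp add: exp_minus field_simps)
      then have "(1/3) ^ m \<le> exp (-1::real) ^ m" by (intro power_mono) auto
      then show ?thesis by (intro divide_right_mono) (auto simp flip: exp_of_nat_mult)
    qed
    also have "\<dots> \<le> exp (- (real m / 2))" by (auto simp flip: exp_diff)
    finally show ?thesis .
  qed
  have "{A \<in> space ?M. \<not> (sqrt m * \<sigma> / 3 * L2_set v {..<n} \<le> L2_set (mat_vec n A v) {..<m}
        \<and> L2_set (mat_vec n A v) {..<m} \<le> 3 * sqrt m * \<sigma> * L2_set v {..<n})}
     \<subseteq> {A \<in> space ?M. 27/8 * m \<le> 3 / (8 * t\<^sup>2) * W A} \<union> {A \<in> space ?M. - (4/9 * m) \<le> - (4 / t\<^sup>2) * W A}"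
  proof
    fix A assume "A \<in> {A \<in> space ?M. \<not> (sqrt m * \<sigma> / 3 * L2_set v {..<n} \<le> L2_set (mat_vec n A v) {..<m}
        \<and> L2_set (mat_vec n A v) {..<m} \<le> 3 * sqrt m * \<sigma> * L2_set v {..<n})}"
    then have A: "A \<in> space ?M"
      and "L2_set (mat_vec n A v) {..<m} \<le> sqrt m * \<sigma> / 3 * L2_set v {..<n}
         \<or> 3 * sqrt m * \<sigma> * L2_set v {..<n} \<le> L2_set (mat_vec n A v) {..<m}"
      by auto
    then have "W A \<le> (sqrt m * \<sigma> / 3 * L2_set v {..<n})\<^sup>2 \<or> (3 * sqrt m * \<sigma> * L2_set v {..<n})\<^sup>2 \<le> W A"
      unfolding W_def using assms by (auto intro!: power_mono)
    then have "W A \<le> m * t\<^sup>2 / 9 \<or> 9 * m * t\<^sup>2 \<le> W A"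
      by (simp add: t_def power_mult_distrib power_divide mult.assoc)
    then show "A \<in> {A \<in> space ?M. 27/8 * m \<le> 3 / (8 * t\<^sup>2) * W A} \<union> {A \<in> space ?M. - (4/9 * m) \<le> - (4 / t\<^sup>2) * W A}"
      using A t by (auto simp: field_simps)
  qed
  then have "measure ?M {A \<in> space ?M. \<not> (sqrt m * \<sigma> / 3 * L2_set v {..<n} \<le> L2_set (mat_vec n A v) {..<m}
        \<and> L2_set (mat_vec n A v) {..<m} \<le> 3 * sqrt m * \<sigma> * L2_set v {..<n})} \<le>
     measure ?M ({A \<in> space ?M. 27/8 * m \<le> 3 / (8 * t\<^sup>2) * W A} \<union> {A \<in> space ?M. - (4/9 * m) \<le> - (4 / t\<^sup>2) * W A})"
    by (intro finite_measure_mono) auto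
  also have "\<dots> \<le> measure ?M {A \<in> space ?M. 27/8 * m \<le> 3 / (8 * t\<^sup>2) * W A} + measure ?M {A \<in> space ?M. - (4/9 * m) \<le> - (4 / t\<^sup>2) * W A}"
    by (rule measure_Un_le) auto
  finally show ?thesis using up low by simp
qed

section \<open>The random event\<close>

text \<open>Keep one term of the binomial expansion of \<open>(1 + x) ^ d\<close> at x = s / d and
  use that the whole is at most \<open>exp s\<close>.\<close>

lemma binomial_le_power_exp:
  assumes "0 < s" "s \<le> d"
  shows "real (d choose s) \<le> (real d / real s) ^ s * exp (real s)"
proof -
  define x where "x = real s / real d"
  have x: "x > 0" using assms by (simp add: x_def)
  have "real (d choose s) * x ^ s \<le> (\<Sum>k\<le>d. real (d choose k) * x ^ k * 1 ^ (d - k))"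
    using x assms member_le_sum[of s "{..d}" "\<lambda>k. real (d choose k) * x ^ k"] by simp
  also have "\<dots> = (1 + x) ^ d" using binomial_ring[of x 1 d] by (simp add: add.commute)
  also have "\<dots> \<le> exp x ^ d" using x by (intro power_mono exp_ge_add_one_self) auto
  also have "\<dots> = exp (real s)" using assms by (simp add: x_def flip: exp_of_nat_mult)
  finally show ?thesis using assms by (simp add: x_def power_divide field_simps)
qed

text \<open>Union bound of the concentration estimate over the net. The lower bound on m is large
  enough to absorb both the cardinality of the net and the binomial coefficient in the required
  failure probability.\<close>

lemma net_event:
  fixes v :: "(nat \<Rightarrow> int) \<Rightarrow> nat \<Rightarrow> real"
  assumes "0 < \<sigma>" "0 < s" "2 * s \<le> d" "s \<le> K"
    and m: "real m \<ge> 20 * real s + 4 * real K * ln (real d / real s)"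
  shows "\<exists>E\<in>sets (gauss_matrix m n \<sigma>). measure (gauss_matrix m n \<sigma>) E > 1 - 1 / real (d choose s) \<and>
    (\<forall>A\<in>E. \<forall>z\<in>int_net d K. sqrt m * \<sigma> / 3 * L2_set (v z) {..<n} \<le> L2_set (mat_vec n A (v z)) {..<m}
        \<and> L2_set (mat_vec n A (v z)) {..<m} \<le> 3 * sqrt m * \<sigma> * L2_set (v z) {..<n})"
proof -
  let ?M = "gauss_matrix m n \<sigma>"
  interpret prob_space ?M by (rule prob_space_gauss_matrix) fact
  define bad where "bad z = {A \<in> space ?M. \<not> (sqrt m * \<sigma> / 3 * L2_set (v z) {..<n} \<le> L2_set (mat_vec n A (v z)) {..<m}
        \<and> L2_set (mat_vec n A (v z)) {..<m} \<le> 3 * sqrt m * \<sigma> * L2_set (v z) {..<n})}" for z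
  have bad: "bad z \<in> sets ?M" for z unfolding bad_def by measurable
  define F where "F = (\<Union>z\<in>int_net d K. bad z)"
  have F: "F \<in> sets ?M" unfolding F_def using bad finite_int_net by auto
  define l where "l = ln (real d / real s)"
  have ds: "real d / real s \<ge> 2" using assms by (simp add: field_simps)
  then have l: "l \<ge> 0" by (simp add: l_def)
  have pw: "(real d / real s) ^ k = exp (real k * l)" for k
    using ds by (simp add: l_def exp_of_nat_mult)
  have "measure ?M F \<le> (\<Sum>z\<in>int_net d K. measure ?M (bad z))"
    unfolding F_def using bad finite_int_net by (intro finite_measure_subadditive_finite) auto
  also have "\<dots> \<le> real (card (int_net d K)) * (2 * exp (- (real m / 2)))"
    using gauss_norm_concentration[OF \<open>0 < \<sigma>\<close>] by (intro sum_bounded_above) (simp add: bad_def)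
  also have "\<dots> \<le> (exp (K * l) * exp (4 * real s)) * (2 * exp (- (real m / 2)))"
  proof (rule mult_right_mono)
    \<comment> \<open>The counting lemma at x = s / d, which is at most 1/2 because 2 * s is at most
      d.\<close>
    have "real (card (int_net d K)) \<le> (1 / (real s / real d)) ^ K * exp (4 * (real s / real d) * real d)"
      using assms by (intro card_int_net_le) (auto simp: field_simps)
    also have "\<dots> = exp (K * l) * exp (4 * real s)" using assms by (simp flip: pw)
    finally show "real (card (int_net d K)) \<le> exp (K * l) * exp (4 * real s)" .
  qed simp
  finally have PF: "measure ?M F \<le> (exp (K * l) * exp (4 * real s)) * (2 * exp (- (real m / 2)))" .
  have ch: "real (d choose s) \<le> exp (s * l) * exp (real s)"
    using binomial_le_power_exp[of s d] assms by (simp add: pw)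
  have "measure ?M F * real (d choose s) \<le>
     ((exp (K * l) * exp (4 * real s)) * (2 * exp (- (real m / 2)))) * (exp (s * l) * exp (real s))"
    by (intro mult_mono PF ch) auto
  also have "\<dots> = 2 * exp (K * l + 4 * real s + - (real m / 2) + (s * l + real s))"
    by (simp only: exp_add mult_ac)
  \<comment> \<open>The factor 2 is at most \<open>exp 1\<close>. By the bound on m the exponent is
    at most -5 * s, since s is at most K, and so lies strictly below -1.\<close>
  also have "\<dots> < exp 1 * exp (- 1)"
  proof (rule mult_le_less_imp_less)
    show "2 \<le> exp (1::real)" using exp_ge_add_one_self[of 1] by simp
    have "s * l \<le> K * l" using l assms by (intro mult_right_mono) auto
    then show "exp (K * l + 4 * real s + - (real m / 2) + (s * l + real s)) < exp (- 1)"
      using m assms(2) unfolding l_def[symmetric] by simp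
  qed auto
  also have "exp 1 * exp (- 1) = (1::real)" by (simp flip: exp_add)
  finally have "measure ?M F * real (d choose s) < 1" .
  moreover have "real (d choose s) > 0" using assms by simp
  ultimately have "measure ?M F < 1 / real (d choose s)" by (simp add: field_simps)
  then have "measure ?M (space ?M - F) > 1 - 1 / real (d choose s)"
    using prob_compl[OF F] by simp
  then show ?thesis
    using F by (intro bexI[of _ "space ?M - F"]) (auto simp: F_def bad_def)
qed

section \<open>Cones of concentrated vectors\<close>

text \<open>Weighted arithmetic-geometric mean inequality for \<open>a\<^sup>2\<close> and 1 with
  weights q / 2 and 1 - q / 2.\<close>

lemma powr_le_of_square:
  fixes a q :: real
  assumes "0 \<le> a" "0 < q" "q \<le> 2"
  shows "a powr q \<le> (1 - q / 2) + q / 2 * a\<^sup>2"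
proof (cases "a = 0")
  case False
  then have "a\<^sup>2 powr (q / 2) * 1 powr (1 - q / 2) \<le> q / 2 * a\<^sup>2 + (1 - q / 2) * 1"
    using assms by (intro Youngs_inequality_0) auto
  moreover have "a\<^sup>2 powr (q / 2) = a powr q"
    using assms False by (simp add: powr_powr flip: powr_numeral)
  ultimately show ?thesis by simp
qed (use assms in simp)

text \<open>At squared norm s the constant does not depend on q. On T,
  \<open>powr_le_of_square\<close> bounds both the l1 and the lq mass by s. Off T, entries of
  modulus at least 1 are bounded by their squares and smaller ones by their q-th powers, giving 1 +
  6/5; the sum is 16/5.\<close>

lemma l1_le_of_cone:
  assumes q: "0 < q" "q \<le> 1" and T: "finite J" "T \<subseteq> J" "card T \<le> s"
    and x2: "(\<Sum>j\<in>J. (x j)\<^sup>2) = real s"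
    and cone: "(\<Sum>j\<in>J - T. \<bar>x j\<bar> powr q) \<le> 6/5 * (\<Sum>j\<in>T. \<bar>x j\<bar> powr q)"
  shows "(\<Sum>j\<in>J. \<bar>x j\<bar>) \<le> 16/5 * real s"
proof -
  have finT: "finite T" using T finite_subset by auto
  have split: "(\<Sum>j\<in>J. f j) = (\<Sum>j\<in>J - T. f j) + (\<Sum>j\<in>T. f j)" for f :: "_ \<Rightarrow> real"
    by (rule sum.subset_diff[OF T(2,1)])
  have T2: "(\<Sum>j\<in>T. (x j)\<^sup>2) \<le> s"
    using split[of "\<lambda>j. (x j)\<^sup>2"] x2 sum_nonneg[of "J - T" "\<lambda>j. (x j)\<^sup>2"] by simp
  have Tq: "(\<Sum>j\<in>T. \<bar>x j\<bar> powr r) \<le> s" if "0 < r" "r \<le> 1" for r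
  proof -
    have "(\<Sum>j\<in>T. \<bar>x j\<bar> powr r) \<le> (\<Sum>j\<in>T. (1 - r / 2) + r / 2 * \<bar>x j\<bar>\<^sup>2)"
      using that by (intro sum_mono powr_le_of_square) auto
    also have "\<dots> = (1 - r / 2) * real (card T) + r / 2 * (\<Sum>j\<in>T. (x j)\<^sup>2)"
      by (simp add: sum.distrib sum_distrib_left)
    also have "\<dots> \<le> (1 - r / 2) * s + r / 2 * s"
      using that T T2 by (intro add_mono mult_left_mono) auto
    finally show ?thesis by (simp add: algebra_simps)
  qed
  have "(\<Sum>j\<in>J - T. \<bar>x j\<bar>) \<le> (\<Sum>j\<in>J - T. (x j)\<^sup>2 + \<bar>x j\<bar> powr q)"
  proof (rule sum_mono)
    fix j
    show "\<bar>x j\<bar> \<le> (x j)\<^sup>2 + \<bar>x j\<bar> powr q"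
    proof (cases "\<bar>x j\<bar> \<ge> 1")
      case True
      then have "\<bar>x j\<bar> * 1 \<le> \<bar>x j\<bar> * \<bar>x j\<bar>" by (intro mult_left_mono) auto
      then have "\<bar>x j\<bar> \<le> (x j)\<^sup>2" by (simp add: power2_eq_square)
      then show ?thesis by (rule add_increasing2[rotated]) simp
    next
      case False
      then have "\<bar>x j\<bar> powr 1 \<le> \<bar>x j\<bar> powr q"
        using q by (intro powr_mono') auto
      then show ?thesis by (simp add: add_increasing)
    qed
  qed
  also have "\<dots> = (\<Sum>j\<in>J - T. (x j)\<^sup>2) + (\<Sum>j\<in>J - T. \<bar>x j\<bar> powr q)" by (rule sum.distrib)
  also have "\<dots> \<le> real s - (\<Sum>j\<in>T. (x j)\<^sup>2) + 6/5 * s"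
    using split[of "\<lambda>j. (x j)\<^sup>2"] x2 cone Tq[OF q] by simp
  finally have "(\<Sum>j\<in>J - T. \<bar>x j\<bar>) \<le> 11/5 * s"
    using sum_nonneg[of T "\<lambda>j. (x j)\<^sup>2"] by simp
  moreover have "(\<Sum>j\<in>T. \<bar>x j\<bar>) \<le> s" using Tq[of 1] by simp
  ultimately show ?thesis using split[of "\<lambda>j. \<bar>x j\<bar>"] by simp
qed

text \<open>For t between 0 and a + b the ratio t / (a + b) is at most its q-th power; adding this
  for t = a and t = b, whose ratios sum to 1, gives the claim.\<close>

lemma powr_add_le:
  fixes a b q :: real
  assumes "0 \<le> a" "0 \<le> b" "0 < q" "q \<le> 1"
  shows "(a + b) powr q \<le> a powr q + b powr q"
proof (cases "a + b = 0")
  case False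
  have frac: "t / (a + b) * (a + b) powr q \<le> t powr q" if "0 \<le> t" "t \<le> a + b" for t
  proof -
    have "t / (a + b) \<le> (t / (a + b)) powr q"
      using powr_mono'[of q 1 "t / (a + b)"] that assms False by simp
    then have "t / (a + b) * (a + b) powr q \<le> (t / (a + b)) powr q * (a + b) powr q"
      by (rule mult_right_mono) simp
    then show ?thesis using that assms False by (simp add: powr_divide)
  qed
  have "(a + b) powr q = a / (a + b) * (a + b) powr q + b / (a + b) * (a + b) powr q"
    using False by (simp flip: distrib_right add_divide_distrib)
  then show ?thesis using frac[of a] frac[of b] assms by simp
qed (use assms in simp)

text \<open>Reverse triangle inequality for the q-th power, keeping u as the main term on T and w
  off T. Completing u from T to all coordinates costs its tail a second time, hence the factor
  2.\<close>

lemma lq_q_add_ge: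
  assumes q: "0 < q" "q \<le> 1" and T: "T \<subseteq> {..<d}"
  shows "lq_q q d (\<lambda>j. u j + w j) \<ge> lq_q q d u - (\<Sum>j\<in>T. \<bar>w j\<bar> powr q)
     + (\<Sum>j\<in>{..<d} - T. \<bar>w j\<bar> powr q) - 2 * (\<Sum>j\<in>{..<d} - T. \<bar>u j\<bar> powr q)"
proof -
  have split: "(\<Sum>j<d. f j) = (\<Sum>j\<in>{..<d} - T. f j) + (\<Sum>j\<in>T. f j)" for f :: "_ \<Rightarrow> real"
    by (rule sum.subset_diff[OF T]) simp
  have tri: "\<bar>a + b\<bar> powr q \<le> \<bar>a\<bar> powr q + \<bar>b\<bar> powr q" for a b :: real
  proof -
    have "\<bar>a + b\<bar> powr q \<le> (\<bar>a\<bar> + \<bar>b\<bar>) powr q" using q by (intro powr_mono2) auto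
    also have "\<dots> \<le> \<bar>a\<bar> powr q + \<bar>b\<bar> powr q" using q by (intro powr_add_le) auto
    finally show ?thesis .
  qed
  have 1: "\<bar>u j\<bar> powr q - \<bar>w j\<bar> powr q \<le> \<bar>u j + w j\<bar> powr q"
    and 2: "\<bar>w j\<bar> powr q - \<bar>u j\<bar> powr q \<le> \<bar>u j + w j\<bar> powr q" for j
    using tri[of "u j + w j" "- w j"] tri[of "u j + w j" "- u j"] by simp_all
  have "(\<Sum>j\<in>T. \<bar>u j\<bar> powr q) - (\<Sum>j\<in>T. \<bar>w j\<bar> powr q) \<le> (\<Sum>j\<in>T. \<bar>u j + w j\<bar> powr q)"
    unfolding sum_subtractf[symmetric] by (intro sum_mono 1)
  moreover have "(\<Sum>j\<in>{..<d} - T. \<bar>w j\<bar> powr q) - (\<Sum>j\<in>{..<d} - T. \<bar>u j\<bar> powr q) \<le> (\<Sum>j\<in>{..<d} - T. \<bar>u j + w j\<bar> powr q)"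
    unfolding sum_subtractf[symmetric] by (intro sum_mono 2)
  ultimately show ?thesis
    unfolding lq_q_def split by linarith
qed

text \<open>Exposes the index set picked by the choice operator in \<open>best_s_term\<close>, so
  that the approximation error becomes a sum over its complement.\<close>

lemma lq_q_best_s_term:
  obtains T where "T \<subseteq> {..<d}" "card T \<le> s"
    "\<And>q. lq_q q d (\<lambda>j. u j - best_s_term d s u j) = (\<Sum>j\<in>{..<d} - T. \<bar>u j\<bar> powr q)"
proof -
  define T where "T = (SOME S. top_set d s u S)"
  have "\<exists>S. top_set d s u S"
    using ex_largest_subset[of "{..<d}" "min s d" "\<lambda>j. \<bar>u j\<bar>"] by (auto simp: top_set_def)
  then have T: "top_set d s u T" unfolding T_def by (rule someI_ex)
  have "lq_q q d (\<lambda>j. u j - best_s_term d s u j) = (\<Sum>j\<in>{..<d} - T. \<bar>u j\<bar> powr q)" for q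
  proof -
    have "lq_q q d (\<lambda>j. u j - best_s_term d s u j) = (\<Sum>j<d. if j \<in> T then 0 else \<bar>u j\<bar> powr q)"
      unfolding lq_q_def best_s_term_def Let_def T_def[symmetric] by (intro sum.cong) auto
    also have "\<dots> = (\<Sum>j\<in>{..<d} - T. \<bar>u j\<bar> powr q)"
      by (intro sum.mono_neutral_cong_right) auto
    finally show ?thesis .
  qed
  then show thesis using that[of T] T by (auto simp: top_set_def)
qed

section \<open>Tight frames\<close>

definition synthesis_op :: "nat \<Rightarrow> (nat \<Rightarrow> nat \<Rightarrow> real) \<Rightarrow> (nat \<Rightarrow> real) \<Rightarrow> (nat \<Rightarrow> real)" where
  "synthesis_op d D x = (\<lambda>i. \<Sum>j<d. D i j * x j)"

lemma synthesis_op_add: "synthesis_op d D (\<lambda>j. x j + y j) = (\<lambda>i. synthesis_op d D x i + synthesis_op d D y i)"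
  by (simp add: synthesis_op_def algebra_simps sum.distrib)

lemma synthesis_op_scale: "synthesis_op d D (\<lambda>j. c * x j) = (\<lambda>i. c * synthesis_op d D x i)"
  by (simp add: synthesis_op_def sum_distrib_left mult_ac)

lemma analysis_op_add: "analysis_op n D (\<lambda>j. x j + y j) = (\<lambda>i. analysis_op n D x i + analysis_op n D y i)"
  by (simp add: analysis_op_def algebra_simps sum.distrib)

lemma analysis_op_diff: "analysis_op n D (\<lambda>j. x j - y j) = (\<lambda>i. analysis_op n D x i - analysis_op n D y i)"
  by (simp add: analysis_op_def algebra_simps sum_subtractf)

lemma mat_vec_add: "mat_vec n A (\<lambda>j. x j + y j) = (\<lambda>i. mat_vec n A x i + mat_vec n A y i)"
  by (simp add: mat_vec_def algebra_simps sum.distrib)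

lemma mat_vec_scale: "mat_vec n A (\<lambda>j. c * x j) = (\<lambda>i. c * mat_vec n A x i)"
  by (simp add: mat_vec_def sum_distrib_left mult_ac)

lemma abs_sum_mult_le_L2_set: "\<bar>\<Sum>i\<in>I. f i * g i\<bar> \<le> L2_set f I * L2_set g I"
proof -
  have "\<bar>\<Sum>i\<in>I. f i * g i\<bar> \<le> (\<Sum>i\<in>I. \<bar>f i\<bar> * \<bar>g i\<bar>)"
    using sum_abs[of "\<lambda>i. f i * g i" I] by (simp add: abs_mult)
  then show ?thesis using L2_set_mult_ineq[of f g I] by linarith
qed

text \<open>Cauchy-Schwarz in every row; the factor is the Frobenius norm. It supplies the
  \<open>bounded\<close> assumption of the seminorm locale.\<close>

lemma L2_set_mat_vec_le:
  "L2_set (mat_vec n A v) {..<m} \<le> L2_set (\<lambda>i. L2_set (\<lambda>k. A (i, k)) {..<n}) {..<m} * L2_set v {..<n}"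
proof -
  have "L2_set (mat_vec n A v) {..<m} \<le> L2_set (\<lambda>i. L2_set v {..<n} * L2_set (\<lambda>k. A (i, k)) {..<n}) {..<m}"
    unfolding mat_vec_def
    by (intro L2_set_le_of_abs_le) (simp add: abs_sum_mult_le_L2_set mult.commute[of "L2_set v {..<n}"])
  then show ?thesis by (simp add: L2_set_scale mult.commute)
qed

context
  fixes n d D assumes frame: "tight_frame n d D"
begin

lemma L2_set_analysis_op: "L2_set (analysis_op n D f) {..<d} = L2_set f {..<n}"
  using frame by (simp add: tight_frame_def L2_set_def)

text \<open>Polarisation of the norm identity.\<close>

lemma tight_frame_inner:
  "(\<Sum>j<d. analysis_op n D f j * analysis_op n D g j) = (\<Sum>i<n. f i * g i)"
proof -
  have "(\<Sum>j<d. (analysis_op n D (\<lambda>i. f i + g i) j)\<^sup>2) = (\<Sum>i<n. (f i + g i)\<^sup>2)"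
    and "(\<Sum>j<d. (analysis_op n D f j)\<^sup>2) = (\<Sum>i<n. (f i)\<^sup>2)"
    and "(\<Sum>j<d. (analysis_op n D g j)\<^sup>2) = (\<Sum>i<n. (g i)\<^sup>2)"
    using frame by (auto simp: tight_frame_def)
  then have "2 * (\<Sum>j<d. analysis_op n D f j * analysis_op n D g j) = 2 * (\<Sum>i<n. f i * g i)"
    by (simp add: analysis_op_add power2_sum sum.distrib mult.assoc flip: sum_distrib_left)
  then show ?thesis by simp
qed

text \<open>Pair f with the i-th unit vector, whose analysis coefficients are the i-th row of
  D.\<close>

lemma synthesis_analysis:
  assumes "i < n"
  shows "synthesis_op d D (analysis_op n D f) i = f i"
proof -
  have "analysis_op n D (\<lambda>k. if k = i then 1 else 0) j = D i j" for j
    using assms by (simp add: analysis_op_def if_distrib cong: if_cong)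
  then show ?thesis
    using tight_frame_inner[of "\<lambda>k. if k = i then 1 else 0" f] assms
    by (simp add: synthesis_op_def if_distrib if_distribR cong: if_cong)
qed

text \<open>Duality: the squared norm of the synthesis v of x is the pairing of x with the analysis
  coefficients of v, which have the same norm as v.\<close>

lemma L2_set_synthesis_op_le: "L2_set (synthesis_op d D x) {..<n} \<le> L2_set x {..<d}"
proof -
  let ?v = "synthesis_op d D x"
  have "(L2_set ?v {..<n})\<^sup>2 = (\<Sum>i<n. ?v i * ?v i)"
    by (simp add: L2_set_def sum_nonneg power2_eq_square)
  also have "\<dots> = (\<Sum>i<n. \<Sum>j<d. x j * (D i j * ?v i))"
    unfolding synthesis_op_def[of d D x] by (simp add: sum_distrib_right mult_ac)
  also have "\<dots> = (\<Sum>j<d. x j * analysis_op n D ?v j)"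
    by (subst sum.swap) (simp add: analysis_op_def sum_distrib_left)
  also have "\<dots> \<le> L2_set x {..<d} * L2_set (analysis_op n D ?v) {..<d}"
    using abs_sum_mult_le_L2_set[of x "analysis_op n D ?v" "{..<d}"] by linarith
  finally have "L2_set ?v {..<n} * L2_set ?v {..<n} \<le> L2_set x {..<d} * L2_set ?v {..<n}"
    by (simp add: L2_set_analysis_op power2_eq_square)
  then show ?thesis
    by (cases "L2_set ?v {..<n} = 0") (auto simp: less_le mult_le_cancel_right)
qed

end

text \<open>The inner product is the bilinear form of the cross Gram matrix in the two coefficient
  vectors, and the entries of that matrix are bounded by the coherence.\<close>

lemma abs_inner_le_coherence:
  assumes f1: "tight_frame n d1 D1" and f2: "tight_frame n d2 D2"
  shows "\<bar>\<Sum>i<n. f i * g i\<bar> \<le> mutual_coherence n d1 d2 D1 D2 *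
     ((\<Sum>j<d1. \<bar>analysis_op n D1 f j\<bar>) * (\<Sum>j<d2. \<bar>analysis_op n D2 g j\<bar>))"
proof -
  let ?a = "analysis_op n D1 f" and ?b = "analysis_op n D2 g"
  define G where "G i j = (\<Sum>k<n. D1 k i * D2 k j)" for i j
  have G: "\<bar>G i j\<bar> \<le> mutual_coherence n d1 d2 D1 D2" if "i < d1" "j < d2" for i j
    unfolding mutual_coherence_def G_def using that by (intro Max_ge) (auto intro!: image_eqI[of _ _ "(i, j)"])
  have col: "analysis_op n D1 g i = (\<Sum>j<d2. G i j * ?b j)" for i
  proof -
    have "analysis_op n D1 g i = (\<Sum>k<n. D1 k i * g k)" by (simp add: analysis_op_def)
    also have "\<dots> = (\<Sum>j<d2. analysis_op n D2 (\<lambda>k. D1 k i) j * ?b j)"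
      by (rule tight_frame_inner[OF f2, symmetric])
    finally show ?thesis by (simp add: analysis_op_def[of n D2 "\<lambda>k. D1 k i"] G_def mult.commute)
  qed
  have "(\<Sum>i<n. f i * g i) = (\<Sum>i<d1. ?a i * analysis_op n D1 g i)"
    by (rule tight_frame_inner[OF f1, symmetric])
  also have "\<dots> = (\<Sum>i<d1. \<Sum>j<d2. ?a i * (G i j * ?b j))"
    by (simp add: col sum_distrib_left)
  finally have eq: "(\<Sum>i<n. f i * g i) = (\<Sum>i<d1. \<Sum>j<d2. ?a i * (G i j * ?b j))" .
  have "\<bar>\<Sum>i<n. f i * g i\<bar> \<le> (\<Sum>i<d1. \<Sum>j<d2. \<bar>?a i * (G i j * ?b j)\<bar>)"
    unfolding eq by (rule order_trans[OF sum_abs], rule sum_mono, rule sum_abs)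
  also have "\<dots> \<le> (\<Sum>i<d1. \<Sum>j<d2. mutual_coherence n d1 d2 D1 D2 * (\<bar>?a i\<bar> * \<bar>?b j\<bar>))"
  proof (intro sum_mono)
    fix i j assume "i \<in> {..<d1}" "j \<in> {..<d2}"
    then have "\<bar>G i j\<bar> * (\<bar>?a i\<bar> * \<bar>?b j\<bar>) \<le> mutual_coherence n d1 d2 D1 D2 * (\<bar>?a i\<bar> * \<bar>?b j\<bar>)"
      by (intro mult_right_mono G) auto
    then show "\<bar>?a i * (G i j * ?b j)\<bar> \<le> mutual_coherence n d1 d2 D1 D2 * (\<bar>?a i\<bar> * \<bar>?b j\<bar>)"
      by (simp add: abs_mult mult.left_commute)
  qed
  also have "\<dots> = mutual_coherence n d1 d2 D1 D2 * ((\<Sum>j<d1. \<bar>?a j\<bar>) * (\<Sum>j<d2. \<bar>?b j\<bar>))"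
    by (subst sum_product) (simp add: sum_distrib_left)
  finally show ?thesis .
qed

lemma sum_abs_le_sqrt_L2_set: "(\<Sum>j<d. \<bar>f j\<bar>) \<le> sqrt (real d) * L2_set f {..<d}"
  using L2_set_mult_ineq[of "\<lambda>_. 1" f "{..<d}"] by (simp add: L2_set_constant)

text \<open>For a unit vector the coherence estimate gives 1 at most the coherence times
  \<open>sqrt (d1 * d2)\<close>; the geometric mean is at most the arithmetic one. Together with an
  upper bound on the coherence this forces d1 + d2 to be large compared with the sparsity.\<close>

lemma mutual_coherence_ge:
  assumes f1: "tight_frame n d1 D1" and f2: "tight_frame n d2 D2" and "0 < n"
  shows "2 \<le> mutual_coherence n d1 d2 D1 D2 * real (d1 + d2)"
proof -
  let ?\<mu> = "mutual_coherence n d1 d2 D1 D2"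
  define f where "f k = (if k = 0 then 1 else 0 :: real)" for k :: nat
  have f: "(\<Sum>i<n. f i * f i) = 1"
    using assms by (simp add: f_def if_distrib cong: if_cong)
  then have f': "L2_set f {..<n} = 1" by (simp add: L2_set_def power2_eq_square)
  let ?P = "(\<Sum>j<d1. \<bar>analysis_op n D1 f j\<bar>) * (\<Sum>j<d2. \<bar>analysis_op n D2 f j\<bar>)"
  have 1: "1 \<le> ?\<mu> * ?P" using abs_inner_le_coherence[OF f1 f2, of f f] f by simp
  have P: "0 \<le> ?P" by (simp add: sum_nonneg)
  \<comment> \<open>The sign is deduced from fact \<open>1\<close> and not from the definition, as
    the maximum of an empty set would be unspecified.\<close>
  have mu: "0 \<le> ?\<mu>"
  proof (rule ccontr)
    assume "\<not> 0 \<le> ?\<mu>"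
    then have "?\<mu> * ?P \<le> 0" using P by (simp add: mult_nonpos_nonneg)
    then show False using 1 by simp
  qed
  have "?P \<le> (sqrt d1 * 1) * (sqrt d2 * 1)"
    using sum_abs_le_sqrt_L2_set[of "analysis_op n D1 f" d1] sum_abs_le_sqrt_L2_set[of "analysis_op n D2 f" d2]
    by (intro mult_mono) (auto simp: L2_set_analysis_op[OF f1] L2_set_analysis_op[OF f2] f' intro!: sum_nonneg)
  also have "\<dots> \<le> (d1 + d2) / 2"
    using arith_geo_mean_sqrt[of d1 d2] by (simp add: real_sqrt_mult)
  finally have "?\<mu> * ?P \<le> ?\<mu> * ((d1 + d2) / 2)" using mu by (intro mult_left_mono) auto
  then show ?thesis using 1 by simp
qed

section \<open>Concatenated coefficient vectors and the joint frame\<close>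

lemma sum_lessThan_add:
  fixes f :: "nat \<Rightarrow> 'a::comm_monoid_add"
  shows "(\<Sum>j<a + b. f j) = (\<Sum>j<a. f j) + (\<Sum>j<b. f (a + j))"
  by (induction b) (simp_all add: add.assoc)

text \<open>The block matrix with blocks D1 and D2, applied to one vector of length d1 + d2 whose
  second block starts at index d1.\<close>

definition joint_synthesis ::
  "nat \<Rightarrow> nat \<Rightarrow> (nat \<Rightarrow> nat \<Rightarrow> real) \<Rightarrow> (nat \<Rightarrow> nat \<Rightarrow> real) \<Rightarrow> (nat \<Rightarrow> real) \<Rightarrow> nat \<Rightarrow> real" where
  "joint_synthesis d1 d2 D1 D2 x i = synthesis_op d1 D1 x i + synthesis_op d2 D2 (\<lambda>j. x (d1 + j)) i"

lemma joint_synthesis_add: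
  "joint_synthesis d1 d2 D1 D2 (\<lambda>j. x j + y j) = (\<lambda>i. joint_synthesis d1 d2 D1 D2 x i + joint_synthesis d1 d2 D1 D2 y i)"
  by (rule ext) (simp add: joint_synthesis_def synthesis_op_add algebra_simps)

lemma joint_synthesis_scale:
  "joint_synthesis d1 d2 D1 D2 (\<lambda>j. c * x j) = (\<lambda>i. c * joint_synthesis d1 d2 D1 D2 x i)"
  by (rule ext) (simp add: joint_synthesis_def synthesis_op_scale algebra_simps)

lemma joint_synthesis_cong:
  assumes "\<And>j. j < d1 + d2 \<Longrightarrow> x j = y j"
  shows "joint_synthesis d1 d2 D1 D2 x = joint_synthesis d1 d2 D1 D2 y"
  using assms by (auto simp: joint_synthesis_def synthesis_op_def intro!: arg_cong2[where f="(+)"] sum.cong)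

text \<open>The block norms a and b satisfy
  \<open>(a + b)\<^sup>2 \<le> 2 * (a\<^sup>2 + b\<^sup>2)\<close>; 3/2 is a rational upper bound
  for \<open>sqrt 2\<close>.\<close>

lemma L2_set_joint_synthesis_le:
  assumes "tight_frame n d1 D1" "tight_frame n d2 D2"
  shows "L2_set (joint_synthesis d1 d2 D1 D2 x) {..<n} \<le> 3/2 * L2_set x {..<d1 + d2}"
proof -
  let ?x2 = "\<lambda>j. x (d1 + j)"
  have "L2_set (joint_synthesis d1 d2 D1 D2 x) {..<n} \<le> L2_set (synthesis_op d1 D1 x) {..<n} + L2_set (synthesis_op d2 D2 ?x2) {..<n}"
    unfolding joint_synthesis_def by (rule L2_set_triangle_ineq)
  also have "\<dots> \<le> L2_set x {..<d1} + L2_set ?x2 {..<d2}"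
    using assms by (intro add_mono L2_set_synthesis_op_le)
  also have "\<dots> \<le> 3/2 * L2_set x {..<d1 + d2}"
  proof (rule power2_le_imp_le)
    let ?a = "L2_set x {..<d1}" and ?b = "L2_set ?x2 {..<d2}"
    have sq: "(L2_set x {..<d1 + d2})\<^sup>2 = ?a\<^sup>2 + ?b\<^sup>2"
      by (simp add: L2_set_def sum_nonneg sum_lessThan_add)
    have "(?a + ?b)\<^sup>2 + (?a - ?b)\<^sup>2 = 2 * (?a\<^sup>2 + ?b\<^sup>2)" by (simp add: power2_eq_square algebra_simps)
    moreover have "0 \<le> (?a - ?b)\<^sup>2" "0 \<le> ?a\<^sup>2" "0 \<le> ?b\<^sup>2" by simp_all
    ultimately have "(?a + ?b)\<^sup>2 \<le> 9/4 * (?a\<^sup>2 + ?b\<^sup>2)" by argo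
    then show "(?a + ?b)\<^sup>2 \<le> (3/2 * L2_set x {..<d1 + d2})\<^sup>2"
      by (simp add: power_mult_distrib sq power_divide)
  qed simp
  finally show ?thesis .
qed

section \<open>Recovery\<close>

text \<open>A nonzero w, scaled to squared norm s, satisfies the hypotheses of
  \<open>pos_of_net\<close>: the cone condition gives the l1 bound, and low coherence keeps its
  synthesis long. So its measurement is nonzero, although the synthesis is a multiple of h1 + h2,
  which lies in the kernel.\<close>

lemma cone_kernel_trivial:
  fixes D1 D2 h1 h2 d1 d2 n
  defines "w \<equiv> \<lambda>j. if j < d1 then analysis_op n D1 h1 j else analysis_op n D2 h2 (j - d1)"
    and "S \<equiv> joint_synthesis d1 d2 D1 D2"
  assumes f1: "tight_frame n d1 D1" and f2: "tight_frame n d2 D2"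
    and q: "0 < q" "q \<le> 1" and "0 < s" "0 < B"
    and \<mu>: "0 \<le> mutual_coherence n d1 d2 D1 D2" "mutual_coherence n d1 d2 D1 D2 * real s * 7 < 1"
    and net: "\<And>z :: nat \<Rightarrow> int. (\<Sum>j<d1 + d2. \<bar>z j\<bar>) \<le> int (10 ^ 12 * s) \<Longrightarrow>
        B / 3 * L2_set (S (\<lambda>j. real_of_int (z j))) {..<n} \<le> L2_set (mat_vec n A (S (\<lambda>j. real_of_int (z j)))) {..<m} \<and>
        L2_set (mat_vec n A (S (\<lambda>j. real_of_int (z j)))) {..<m} \<le> 3 * B * L2_set (S (\<lambda>j. real_of_int (z j))) {..<n}"
    and ker: "\<And>i. i < m \<Longrightarrow> mat_vec n A (\<lambda>k. h1 k + h2 k) i = 0"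
    and T: "T \<subseteq> {..<d1 + d2}" "card T \<le> s"
    and cone: "(\<Sum>j\<in>{..<d1 + d2} - T. \<bar>w j\<bar> powr q) \<le> 6/5 * (\<Sum>j\<in>T. \<bar>w j\<bar> powr q)"
  shows "L2_set w {..<d1 + d2} = 0"
proof (rule ccontr)
  assume "L2_set w {..<d1 + d2} \<noteq> 0"
  then have pos: "L2_set w {..<d1 + d2} > 0" by (simp add: less_le)
  define c where "c = sqrt s / L2_set w {..<d1 + d2}"
  have c: "c > 0" using pos \<open>0 < s\<close> by (simp add: c_def)
  define x where "x j = c * w j" for j
  let ?\<mu> = "mutual_coherence n d1 d2 D1 D2"
  let ?N = "\<lambda>x. L2_set (S x) {..<n}" and ?p = "\<lambda>x. L2_set (mat_vec n A (S x)) {..<m}"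
  have w2: "(L2_set w {..<d1 + d2})\<^sup>2 = (\<Sum>k<n. (h1 k)\<^sup>2) + (\<Sum>k<n. (h2 k)\<^sup>2)"
    using f1 f2 by (simp add: L2_set_def sum_nonneg sum_lessThan_add w_def tight_frame_def)
  have cs: "c\<^sup>2 * (L2_set w {..<d1 + d2})\<^sup>2 = s"
    using pos by (simp add: c_def power_divide)
  have x2: "(\<Sum>j<d1 + d2. (x j)\<^sup>2) = real s"
    using cs by (simp add: x_def power_mult_distrib L2_set_def sum_nonneg flip: sum_distrib_left)
  have "(\<Sum>j\<in>I. \<bar>x j\<bar> powr q) = c powr q * (\<Sum>j\<in>I. \<bar>w j\<bar> powr q)" for I
    using c by (simp add: x_def abs_mult powr_mult sum_distrib_left)
  then have "(\<Sum>j\<in>{..<d1 + d2} - T. \<bar>x j\<bar> powr q) \<le> 6/5 * (\<Sum>j\<in>T. \<bar>x j\<bar> powr q)"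
    using mult_left_mono[OF cone, of "c powr q"] by simp
  then have x1: "(\<Sum>j<d1 + d2. \<bar>x j\<bar>) \<le> 16/5 * real s"
    by (intro l1_le_of_cone[OF q _ T x2]) auto
  have Sx: "S x k = c * (h1 k + h2 k)" if "k < n" for k
  proof -
    have "S w k = synthesis_op d1 D1 (analysis_op n D1 h1) k + synthesis_op d2 D2 (analysis_op n D2 h2) k"
      unfolding S_def joint_synthesis_def synthesis_op_def w_def by simp
    also have "\<dots> = h1 k + h2 k"
      using that f1 f2 by (simp add: synthesis_analysis)
    finally show ?thesis by (simp add: x_def[abs_def] S_def joint_synthesis_scale)
  qed
  \<comment> \<open>The product of the two block l1 norms is at most a quarter of the squared l1
    norm, \<open>64/25 * s\<^sup>2\<close>. The coherence bound divides this by
    \<open>7 * s\<close>, and 64/175 is below 3/8.\<close>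
  have inner: "c\<^sup>2 * \<bar>\<Sum>k<n. h1 k * h2 k\<bar> \<le> 3/8 * s"
  proof -
    let ?a = "\<Sum>j<d1. \<bar>analysis_op n D1 h1 j\<bar>" and ?b = "\<Sum>j<d2. \<bar>analysis_op n D2 h2 j\<bar>"
    have ab: "c * ?a + c * ?b = (\<Sum>j<d1 + d2. \<bar>x j\<bar>)"
      using c by (simp add: sum_lessThan_add x_def w_def abs_mult sum_distrib_left)
    have "4 * ((c * ?a) * (c * ?b)) = (c * ?a + c * ?b)\<^sup>2 - (c * ?a - c * ?b)\<^sup>2"
      by (simp add: power2_eq_square algebra_simps)
    also have "\<dots> \<le> (c * ?a + c * ?b)\<^sup>2" by simp
    also have "\<dots> \<le> (16/5 * real s)\<^sup>2"
      unfolding ab by (intro power_mono x1 sum_nonneg) auto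
    finally have "(c * ?a) * (c * ?b) \<le> 64/25 * (real s)\<^sup>2" by (simp add: power_mult_distrib power_divide mult_ac)
    then have "?\<mu> * ((c * ?a) * (c * ?b)) \<le> ?\<mu> * (64/25 * (real s)\<^sup>2)" using \<mu> by (intro mult_left_mono)
    also have "\<dots> = (?\<mu> * real s * 7) * (64/175 * real s)" by (simp add: power2_eq_square)
    also have "\<dots> \<le> 1 * (64/175 * real s)" using \<mu> by (intro mult_right_mono) auto
    finally have "?\<mu> * ((c * ?a) * (c * ?b)) \<le> 3/8 * s" by simp
    moreover have "c\<^sup>2 * \<bar>\<Sum>k<n. h1 k * h2 k\<bar> \<le> c\<^sup>2 * (?\<mu> * (?a * ?b))"
      using abs_inner_le_coherence[OF f1 f2] by (intro mult_left_mono) auto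
    moreover have "c\<^sup>2 * (?\<mu> * (?a * ?b)) = ?\<mu> * ((c * ?a) * (c * ?b))"
      by (simp add: power2_eq_square)
    ultimately show ?thesis by linarith
  qed
  \<comment> \<open>Expanding the square, the cross term costs at most \<open>3/4 * s\<close> of the
    total s, leaving s / 4.\<close>
  have Nx: "?N x \<ge> 1/2 * sqrt s"
    unfolding L2_set_def
  proof (rule real_le_rsqrt)
    have "(\<Sum>k<n. (S x k)\<^sup>2) = (\<Sum>k<n. (c * (h1 k + h2 k))\<^sup>2)"
      by (intro sum.cong) (auto simp: Sx)
    also have "\<dots> = c\<^sup>2 * (\<Sum>k<n. (h1 k + h2 k)\<^sup>2)" by (simp add: power_mult_distrib sum_distrib_left)
    also have "(\<Sum>k<n. (h1 k + h2 k)\<^sup>2) = (L2_set w {..<d1 + d2})\<^sup>2 + 2 * (\<Sum>k<n. h1 k * h2 k)"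
      unfolding w2 by (simp add: power2_sum sum.distrib sum_distrib_left mult.assoc)
    also have "c\<^sup>2 * \<dots> = s + 2 * (c\<^sup>2 * (\<Sum>k<n. h1 k * h2 k))"
      using cs by (simp add: distrib_left)
    finally have eq: "(\<Sum>k<n. (S x k)\<^sup>2) = s + 2 * (c\<^sup>2 * (\<Sum>k<n. h1 k * h2 k))" .
    have "c\<^sup>2 * (\<Sum>k<n. h1 k * h2 k) \<ge> - (c\<^sup>2 * \<bar>\<Sum>k<n. h1 k * h2 k\<bar>)"
      using mult_left_mono[of "- \<bar>\<Sum>k<n. h1 k * h2 k\<bar>" "\<Sum>k<n. h1 k * h2 k" "c\<^sup>2"] by simp
    then show "(1/2 * sqrt s)\<^sup>2 \<le> (\<Sum>k<n. (S x k)\<^sup>2)"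
      unfolding eq using inner by (simp add: power_mult_distrib power_divide)
  qed
  interpret seminorm_on_coords "d1 + d2" ?p
  proof
    fix y z :: "nat \<Rightarrow> real" and r :: real
    show "?p (\<lambda>j. y j + z j) \<le> ?p y + ?p z"
      unfolding S_def joint_synthesis_add mat_vec_add by (rule L2_set_triangle_ineq)
    show "?p (\<lambda>j. r * y j) = \<bar>r\<bar> * ?p y"
      unfolding S_def joint_synthesis_scale mat_vec_scale by (rule L2_set_scale)
    let ?F = "L2_set (\<lambda>i. L2_set (\<lambda>k. A (i, k)) {..<n}) {..<m}"
    have "?p y \<le> ?F * (3/2) * L2_set y {..<d1 + d2}" for y
    proof -
      have "?p y \<le> ?F * ?N y" by (rule L2_set_mat_vec_le)
      also have "\<dots> \<le> ?F * (3/2 * L2_set y {..<d1 + d2})"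
        unfolding S_def by (intro mult_left_mono L2_set_joint_synthesis_le f1 f2) simp
      finally show ?thesis by simp
    qed
    then show "\<exists>B. \<forall>y. ?p y \<le> B * L2_set y {..<d1 + d2}" by blast
  qed
  have "?p x > 0"
  proof (rule pos_of_net[OF \<open>0 < s\<close> \<open>0 < B\<close>, of ?N])
    show "?N (\<lambda>j. y j + z j) \<le> ?N y + ?N z" for y z
      unfolding S_def joint_synthesis_add by (rule L2_set_triangle_ineq)
    show "?N (\<lambda>j. r * y j) = \<bar>r\<bar> * ?N y" for r y
      unfolding S_def joint_synthesis_scale by (rule L2_set_scale)
    show "?N y \<le> 3/2 * L2_set y {..<d1 + d2}" for y
      unfolding S_def by (rule L2_set_joint_synthesis_le[OF f1 f2])
  qed (use net x1 x2 Nx in auto)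
  moreover have "mat_vec n A (S x) i = 0" if "i < m" for i
  proof -
    have "mat_vec n A (S x) i = mat_vec n A (\<lambda>k. c * (h1 k + h2 k)) i"
      unfolding mat_vec_def by (intro sum.cong) (auto simp: Sx)
    also have "\<dots> = 0" using ker[OF that] by (simp add: mat_vec_scale)
    finally show ?thesis .
  qed
  then have "?p x = 0" by (simp add: L2_set_eq_0_iff)
  ultimately show False by simp
qed

text \<open>The base exceeds 5 strictly and the exponent is at least 1, so the ceiling is at least
  6; the second factor is at least 1. The value 7 is all that later estimates use of this
  expression.\<close>

lemma lq_coherence_factor_ge:
  assumes "0 < q" "q \<le> 1"
  shows "7 \<le> (real_of_int \<lceil>(2 powr (3 * q / 2) * 5) powr (2 / (2 - q))\<rceil> + 1) * (1 / (8 * 5 powr (2 / q)) + 1)"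
proof -
  let ?b = "2 powr (3 * q / 2) * 5 :: real"
  have "2 powr 0 < (2::real) powr (3 * q / 2)" using assms by (intro powr_less_mono) auto
  then have b: "5 < ?b" by simp
  also have "?b = ?b powr 1" by simp
  also have "\<dots> \<le> ?b powr (2 / (2 - q))"
  proof (rule powr_mono)
    show "1 \<le> 2 / (2 - q)" using assms by (simp add: field_simps)
    show "1 \<le> ?b" using b by linarith
  qed
  finally have "6 \<le> \<lceil>?b powr (2 / (2 - q))\<rceil>" by linarith
  then have "7 \<le> real_of_int \<lceil>?b powr (2 / (2 - q))\<rceil> + 1" by linarith
  then have "7 * 1 \<le> (real_of_int \<lceil>?b powr (2 / (2 - q))\<rceil> + 1) * (1 / (8 * 5 powr (2 / q)) + 1)"
    by (intro mult_mono) auto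
  then show ?thesis by simp
qed

text \<open>Each entry is bounded by the full lq quasi-norm. The dimension factor is affordable
  because the final constant may depend on d.\<close>

lemma L2_set_le_powr_sum:
  assumes "0 < q"
  shows "L2_set w {..<d} \<le> real d * (\<Sum>j<d. \<bar>w j\<bar> powr q) powr (1 / q)"
proof -
  have "L2_set w {..<d} \<le> (\<Sum>j<d. \<bar>w j\<bar>)" by (rule L2_set_le_sum_abs)
  also have "\<dots> \<le> real (card {..<d}) * (\<Sum>j<d. \<bar>w j\<bar> powr q) powr (1 / q)"
  proof (rule sum_bounded_above)
    fix i assume "i \<in> {..<d}"
    then have "\<bar>w i\<bar> powr q \<le> (\<Sum>j<d. \<bar>w j\<bar> powr q)"
      by (intro member_le_sum) auto
    then have "(\<bar>w i\<bar> powr q) powr (1 / q) \<le> (\<Sum>j<d. \<bar>w j\<bar> powr q) powr (1 / q)"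
      using assms by (intro powr_mono2) auto
    then show "\<bar>w i\<bar> \<le> (\<Sum>j<d. \<bar>w j\<bar> powr q) powr (1 / q)"
      using assms by (simp add: powr_powr)
  qed
  finally show ?thesis by simp
qed

text \<open>Dichotomy on the cone condition with constant 6/5: if it holds, the error vanishes by
  \<open>cone_kernel_trivial\<close>; if it fails, the lq mass of the error is already dominated by
  the approximation error.\<close>

lemma recovery_on_net_event:
  fixes D1 D2 d1 d2 n
  defines "S \<equiv> joint_synthesis d1 d2 D1 D2"
  assumes F1: "tight_frame n d1 D1" and F2: "tight_frame n d2 D2"
    and q: "0 < q" "q \<le> 1" and s: "0 < s1 + s2" and "0 < B"
    and \<mu>: "0 \<le> mutual_coherence n d1 d2 D1 D2" "mutual_coherence n d1 d2 D1 D2 * real (s1 + s2) * 7 < 1"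
    and net: "\<And>z :: nat \<Rightarrow> int. (\<Sum>j<d1 + d2. \<bar>z j\<bar>) \<le> int (10 ^ 12 * (s1 + s2)) \<Longrightarrow>
        B / 3 * L2_set (S (\<lambda>j. real_of_int (z j))) {..<n} \<le> L2_set (mat_vec n A (S (\<lambda>j. real_of_int (z j)))) {..<m} \<and>
        L2_set (mat_vec n A (S (\<lambda>j. real_of_int (z j)))) {..<m} \<le> 3 * B * L2_set (S (\<lambda>j. real_of_int (z j))) {..<n}"
    and sol: "is_lq_solution q m n d1 d2 A D1 D2 (mat_vec n A (\<lambda>k. f1 k + f2 k)) g1 g2"
  shows "l2norm n (\<lambda>i. g1 i - f1 i) + l2norm n (\<lambda>i. g2 i - f2 i)
     \<le> real (d1 + d2) * (22 * (lq_q q d1 (\<lambda>j. analysis_op n D1 f1 j - best_s_term d1 s1 (analysis_op n D1 f1) j)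
          + lq_q q d2 (\<lambda>j. analysis_op n D2 f2 j - best_s_term d2 s2 (analysis_op n D2 f2) j))) powr (1 / q)"
proof -
  let ?u1 = "analysis_op n D1 f1" and ?u2 = "analysis_op n D2 f2"
  define h1 where "h1 i = g1 i - f1 i" for i
  define h2 where "h2 i = g2 i - f2 i" for i
  let ?w1 = "analysis_op n D1 h1" and ?w2 = "analysis_op n D2 h2"
  define w where "w j = (if j < d1 then ?w1 j else ?w2 (j - d1))" for j
  obtain T1 where T1: "T1 \<subseteq> {..<d1}" "card T1 \<le> s1"
    and e1: "lq_q q d1 (\<lambda>j. ?u1 j - best_s_term d1 s1 ?u1 j) = (\<Sum>j\<in>{..<d1} - T1. \<bar>?u1 j\<bar> powr q)"
    using lq_q_best_s_term[of d1 s1 ?u1] by metis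
  obtain T2 where T2: "T2 \<subseteq> {..<d2}" "card T2 \<le> s2"
    and e2: "lq_q q d2 (\<lambda>j. ?u2 j - best_s_term d2 s2 ?u2 j) = (\<Sum>j\<in>{..<d2} - T2. \<bar>?u2 j\<bar> powr q)"
    using lq_q_best_s_term[of d2 s2 ?u2] by metis
  define e where "e = lq_q q d1 (\<lambda>j. ?u1 j - best_s_term d1 s1 ?u1 j) + lq_q q d2 (\<lambda>j. ?u2 j - best_s_term d2 s2 ?u2 j)"
  have e: "0 \<le> e" by (simp add: e_def lq_q_def sum_nonneg)
  define T where "T = T1 \<union> (+) d1 ` T2"
  have Tsub: "T \<subseteq> {..<d1 + d2}" using T1 T2 by (auto simp: T_def)
  have "card T \<le> card T1 + card ((+) d1 ` T2)" unfolding T_def by (rule card_Un_le)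
  also have "\<dots> \<le> s1 + s2" using T1 T2 by (simp add: card_image)
  finally have Tcard: "card T \<le> s1 + s2" .
  have fin: "finite T1" "finite T2" using T1 T2 finite_subset by auto
  have sumT: "(\<Sum>j\<in>T. \<bar>w j\<bar> powr q) = (\<Sum>j\<in>T1. \<bar>?w1 j\<bar> powr q) + (\<Sum>j\<in>T2. \<bar>?w2 j\<bar> powr q)"
  proof -
    have "(\<Sum>j\<in>T. \<bar>w j\<bar> powr q) = (\<Sum>j\<in>T1. \<bar>w j\<bar> powr q) + (\<Sum>j\<in>(+) d1 ` T2. \<bar>w j\<bar> powr q)"
      unfolding T_def using T1 fin by (intro sum.union_disjoint) auto
    also have "(\<Sum>j\<in>(+) d1 ` T2. \<bar>w j\<bar> powr q) = (\<Sum>j\<in>T2. \<bar>?w2 j\<bar> powr q)"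
      by (subst sum.reindex) (auto simp: w_def)
    also have "(\<Sum>j\<in>T1. \<bar>w j\<bar> powr q) = (\<Sum>j\<in>T1. \<bar>?w1 j\<bar> powr q)"
      using T1 by (intro sum.cong) (auto simp: w_def)
    finally show ?thesis .
  qed
  have sumd: "(\<Sum>j<d1 + d2. \<bar>w j\<bar> powr q) = (\<Sum>j<d1. \<bar>?w1 j\<bar> powr q) + (\<Sum>j<d2. \<bar>?w2 j\<bar> powr q)"
    by (simp add: sum_lessThan_add w_def)
  have splitT: "(\<Sum>j<d1 + d2. \<bar>w j\<bar> powr q) = (\<Sum>j\<in>{..<d1 + d2} - T. \<bar>w j\<bar> powr q) + (\<Sum>j\<in>T. \<bar>w j\<bar> powr q)"
    by (rule sum.subset_diff[OF Tsub]) simp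
  have split1: "(\<Sum>j<d1. \<bar>?w1 j\<bar> powr q) = (\<Sum>j\<in>{..<d1} - T1. \<bar>?w1 j\<bar> powr q) + (\<Sum>j\<in>T1. \<bar>?w1 j\<bar> powr q)"
    by (rule sum.subset_diff[OF T1(1)]) simp
  have split2: "(\<Sum>j<d2. \<bar>?w2 j\<bar> powr q) = (\<Sum>j\<in>{..<d2} - T2. \<bar>?w2 j\<bar> powr q) + (\<Sum>j\<in>T2. \<bar>?w2 j\<bar> powr q)"
    by (rule sum.subset_diff[OF T2(1)]) simp
  \<comment> \<open>Optimality is compared with the feasible pair (f1, f2).\<close>
  have "lq_q q d1 (analysis_op n D1 g1) + lq_q q d2 (analysis_op n D2 g2) \<le> lq_q q d1 ?u1 + lq_q q d2 ?u2"
    using sol by (auto simp: is_lq_solution_def)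
  moreover have "analysis_op n D1 g1 = (\<lambda>j. ?u1 j + ?w1 j)" "analysis_op n D2 g2 = (\<lambda>j. ?u2 j + ?w2 j)"
    by (simp_all add: h1_def[abs_def] h2_def[abs_def] analysis_op_diff)
  ultimately have cone: "(\<Sum>j\<in>{..<d1 + d2} - T. \<bar>w j\<bar> powr q) \<le> (\<Sum>j\<in>T. \<bar>w j\<bar> powr q) + 2 * e"
    using lq_q_add_ge[OF q T1(1), of ?u1 ?w1] lq_q_add_ge[OF q T2(1), of ?u2 ?w2]
      splitT sumd sumT split1 split2 e1 e2 e_def by simp
  \<comment> \<open>If the cone condition fails, the slack 2 * e exceeds 1/5 of the mass on T. That
    mass is then below 10 * e and the mass off T below 12 * e, which gives 22.\<close>
  have total: "(\<Sum>j<d1 + d2. \<bar>w j\<bar> powr q) \<le> 22 * e"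
  proof (cases "(\<Sum>j\<in>{..<d1 + d2} - T. \<bar>w j\<bar> powr q) \<le> 6/5 * (\<Sum>j\<in>T. \<bar>w j\<bar> powr q)")
    case True
    have "mat_vec n A (\<lambda>k. h1 k + h2 k) i = 0" if "i < m" for i
    proof -
      have "mat_vec n A (\<lambda>k. (f1 k + f2 k) + (h1 k + h2 k)) i = mat_vec n A (\<lambda>k. f1 k + f2 k) i"
        using sol that by (simp add: is_lq_solution_def h1_def h2_def algebra_simps)
      then show ?thesis unfolding mat_vec_add[of n A "\<lambda>k. f1 k + f2 k" "\<lambda>k. h1 k + h2 k"] by simp
    qed
    from cone_kernel_trivial[OF F1 F2 q s \<open>0 < B\<close> \<mu> net[unfolded S_def] this Tsub Tcard True[unfolded w_def[abs_def]]]
    have "L2_set w {..<d1 + d2} = 0" by (simp add: w_def[abs_def])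
    then have "(\<Sum>j<d1 + d2. \<bar>w j\<bar> powr q) = 0" by (simp add: L2_set_eq_0_iff)
    then show ?thesis using e by simp
  next
    case False
    then show ?thesis using cone splitT by linarith
  qed
  have norm: "l2norm k = (\<lambda>x. L2_set x {..<k})" for k by (simp add: l2norm_def L2_set_def fun_eq_iff)
  have le1: "(\<Sum>j<d1. \<bar>?w1 j\<bar> powr q) \<le> 22 * e"
    using total sum_nonneg[of "{..<d2}" "\<lambda>j. \<bar>?w2 j\<bar> powr q"] unfolding sumd by simp
  have "l2norm n h1 \<le> real d1 * (\<Sum>j<d1. \<bar>?w1 j\<bar> powr q) powr (1 / q)"
    unfolding norm L2_set_analysis_op[OF F1, symmetric] using q by (intro L2_set_le_powr_sum)
  also have "\<dots> \<le> real d1 * (22 * e) powr (1 / q)"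
    using le1 q by (intro mult_left_mono powr_mono2 sum_nonneg) auto
  finally have 1: "l2norm n h1 \<le> real d1 * (22 * e) powr (1 / q)" .
  have le2: "(\<Sum>j<d2. \<bar>?w2 j\<bar> powr q) \<le> 22 * e"
    using total sum_nonneg[of "{..<d1}" "\<lambda>j. \<bar>?w1 j\<bar> powr q"] unfolding sumd by simp
  have "l2norm n h2 \<le> real d2 * (\<Sum>j<d2. \<bar>?w2 j\<bar> powr q) powr (1 / q)"
    unfolding norm L2_set_analysis_op[OF F2, symmetric] using q by (intro L2_set_le_powr_sum)
  also have "\<dots> \<le> real d2 * (22 * e) powr (1 / q)"
    using le2 q by (intro mult_left_mono powr_mono2 sum_nonneg) auto
  finally have 2: "l2norm n h2 \<le> real d2 * (22 * e) powr (1 / q)" .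
  show ?thesis
    using 1 2 unfolding h1_def[abs_def] h2_def[abs_def] e_def by (simp add: distrib_right)
qed

theorem theorem1p2:
  fixes q :: real
  assumes "0 < q" and "q \<le> 1"
  shows "\<exists>C1 C2 :: real. C1 > 0 \<and> C2 > 0 \<and>
    (\<forall>(n::nat) (d1::nat) (d2::nat) (m::nat) (D1::nat \<Rightarrow> nat \<Rightarrow> real) (D2::nat \<Rightarrow> nat \<Rightarrow> real)
       (\<sigma>::real) (s1::nat) (s2::nat).
      0 < n \<longrightarrow> tight_frame n d1 D1 \<longrightarrow> tight_frame n d2 D2 \<longrightarrow> 0 < \<sigma> \<longrightarrow>
      0 < s1 \<longrightarrow> 0 < s2 \<longrightarrow>
      mutual_coherence n d1 d2 D1 D2 * real (s1 + s2)
        * (real_of_int \<lceil>(2 powr (3 * q / 2) * 5) powr (2 / (2 - q))\<rceil> + 1)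
        * (1 / (8 * 5 powr (2 / q)) + 1) < 1 \<longrightarrow>
      real m \<ge> C1 * real (s1 + s2)
               + q * C2 * real (s1 + s2) * ln (real (d1 + d2) / real (s1 + s2)) \<longrightarrow>
      (\<exists>C > 0. \<forall>f1 f2 :: nat \<Rightarrow> real.
         \<exists>E \<in> sets (gauss_matrix m n \<sigma>).
           measure (gauss_matrix m n \<sigma>) E > 1 - 1 / real ((d1 + d2) choose (s1 + s2)) \<and>
           (\<forall>A \<in> E. \<forall>g1 g2.
              is_lq_solution q m n d1 d2 A D1 D2 (mat_vec n A (\<lambda>k. f1 k + f2 k)) g1 g2 \<longrightarrow>
              l2norm n (\<lambda>i. g1 i - f1 i) + l2norm n (\<lambda>i. g2 i - f2 i)
              \<le> C * (lq_q q d1 (\<lambda>j. analysis_op n D1 f1 j - best_s_term d1 s1 (analysis_op n D1 f1) j)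
                    + lq_q q d2 (\<lambda>j. analysis_op n D2 f2 j - best_s_term d2 s2 (analysis_op n D2 f2) j))
                    powr (1 / q)
                / real (s1 + s2) powr (1 / q - 1 / 2))))"
\<comment> \<open>Both constants come from \<open>net_event\<close> with net radius
  \<open>10 ^ 12 * s\<close>; dividing by q cancels the factor q in front of C2.\<close>
proof (rule exI[of _ "20::real"], rule exI[of _ "4 * 10 ^ 12 / q"], intro conjI allI impI)
  show "0 < (20::real)" "0 < 4 * 10 ^ 12 / q" using assms by simp_all
next
  fix n d1 d2 m :: nat and D1 D2 :: "nat \<Rightarrow> nat \<Rightarrow> real" and \<sigma> :: real and s1 s2 :: nat
  assume n: "0 < n" and F: "tight_frame n d1 D1" "tight_frame n d2 D2" and \<sigma>: "0 < \<sigma>" and s12: "0 < s1" "0 < s2"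
    and coh: "mutual_coherence n d1 d2 D1 D2 * real (s1 + s2)
        * (real_of_int \<lceil>(2 powr (3 * q / 2) * 5) powr (2 / (2 - q))\<rceil> + 1)
        * (1 / (8 * 5 powr (2 / q)) + 1) < 1"
    and m: "real m \<ge> 20 * real (s1 + s2)
               + q * (4 * 10 ^ 12 / q) * real (s1 + s2) * ln (real (d1 + d2) / real (s1 + s2))"
  define s where "s = s1 + s2"
  define d where "d = d1 + d2"
  let ?\<mu> = "mutual_coherence n d1 d2 D1 D2"
  let ?S = "joint_synthesis d1 d2 D1 D2"
  have s: "0 < s" using s12 by (simp add: s_def)
  have \<mu>d: "2 \<le> ?\<mu> * real d" unfolding d_def by (rule mutual_coherence_ge[OF F n])
  have d: "0 < d" using \<mu>d by (cases d) auto
  have \<mu>: "0 < ?\<mu>" using \<mu>d d by (metis less_le_trans of_nat_0_less_iff zero_less_mult_pos2 zero_less_numeral)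
  have \<mu>7: "?\<mu> * real s * 7 < 1"
  proof -
    have "?\<mu> * real s * 7 \<le> ?\<mu> * real s * ((real_of_int \<lceil>(2 powr (3 * q / 2) * 5) powr (2 / (2 - q))\<rceil> + 1)
        * (1 / (8 * 5 powr (2 / q)) + 1))"
      using \<mu> assms by (intro mult_left_mono lq_coherence_factor_ge) auto
    then show ?thesis using coh unfolding s_def by (simp only: mult.assoc)
  qed
  \<comment> \<open>The left side is below 1 by the coherence hypothesis, the right side at least 2
    by \<open>mutual_coherence_ge\<close>. This yields the condition 2 * s at most d needed to count
    the net.\<close>
  have "?\<mu> * (2 * real s) < ?\<mu> * real d" using \<mu>7 \<mu>d by simp
  then have sd: "2 * s \<le> d" using \<mu> by (simp add: mult_less_cancel_left_pos)
  have ds: "real d / real s \<ge> 1" using sd s by (simp add: field_simps)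
  have m': "real m \<ge> 20 * real s + 4 * real (10 ^ 12 * s) * ln (real d / real s)"
    using m assms by (simp add: s_def d_def)
  have "0 \<le> 4 * real (10 ^ 12 * s) * ln (real d / real s)" using ds by simp
  then have "m > 0" using m' s by (cases m) auto
  then have B: "sqrt m * \<sigma> > 0" using \<sigma> by simp
  \<comment> \<open>The event is fixed before the signals are introduced, so one E serves all f1 and
    f2.\<close>
  obtain E where E: "E \<in> sets (gauss_matrix m n \<sigma>)" "measure (gauss_matrix m n \<sigma>) E > 1 - 1 / real (d choose s)"
    and net: "\<And>A z. A \<in> E \<Longrightarrow> z \<in> int_net d (10 ^ 12 * s) \<Longrightarrow>
        sqrt m * \<sigma> / 3 * L2_set (?S (\<lambda>j. real_of_int (z j))) {..<n} \<le> L2_set (mat_vec n A (?S (\<lambda>j. real_of_int (z j)))) {..<m}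
        \<and> L2_set (mat_vec n A (?S (\<lambda>j. real_of_int (z j)))) {..<m} \<le> 3 * sqrt m * \<sigma> * L2_set (?S (\<lambda>j. real_of_int (z j))) {..<n}"
    using net_event[OF \<sigma> s sd _ m', of n "\<lambda>z. ?S (\<lambda>j. real_of_int (z j))"] s by auto
  \<comment> \<open>The last factor cancels the denominator of the claimed bound; the others are
    those of \<open>recovery_on_net_event\<close>.\<close>
  define C where "C = real d * 22 powr (1 / q) * real s powr (1 / q - 1 / 2)"
  show "\<exists>C > 0. \<forall>f1 f2 :: nat \<Rightarrow> real.
         \<exists>E \<in> sets (gauss_matrix m n \<sigma>).
           measure (gauss_matrix m n \<sigma>) E > 1 - 1 / real ((d1 + d2) choose (s1 + s2)) \<and>
           (\<forall>A \<in> E. \<forall>g1 g2.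
              is_lq_solution q m n d1 d2 A D1 D2 (mat_vec n A (\<lambda>k. f1 k + f2 k)) g1 g2 \<longrightarrow>
              l2norm n (\<lambda>i. g1 i - f1 i) + l2norm n (\<lambda>i. g2 i - f2 i)
              \<le> C * (lq_q q d1 (\<lambda>j. analysis_op n D1 f1 j - best_s_term d1 s1 (analysis_op n D1 f1) j)
                    + lq_q q d2 (\<lambda>j. analysis_op n D2 f2 j - best_s_term d2 s2 (analysis_op n D2 f2) j))
                    powr (1 / q)
                / real (s1 + s2) powr (1 / q - 1 / 2))"
  proof (intro exI[of _ C] conjI allI bexI[of _ E] ballI impI)
    show "C > 0" using d s by (simp add: C_def)
    show "E \<in> sets (gauss_matrix m n \<sigma>)" by (rule E)
    show "measure (gauss_matrix m n \<sigma>) E > 1 - 1 / real ((d1 + d2) choose (s1 + s2))"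
      using E by (simp add: s_def d_def)
  next
    fix f1 f2 A g1 g2
    assume A: "A \<in> E" and sol: "is_lq_solution q m n d1 d2 A D1 D2 (mat_vec n A (\<lambda>k. f1 k + f2 k)) g1 g2"
    let ?e = "lq_q q d1 (\<lambda>j. analysis_op n D1 f1 j - best_s_term d1 s1 (analysis_op n D1 f1) j)
                    + lq_q q d2 (\<lambda>j. analysis_op n D2 f2 j - best_s_term d2 s2 (analysis_op n D2 f2) j)"
    have "l2norm n (\<lambda>i. g1 i - f1 i) + l2norm n (\<lambda>i. g2 i - f2 i) \<le> real (d1 + d2) * (22 * ?e) powr (1 / q)"
    proof (rule recovery_on_net_event[OF F assms _ B _ _ _ sol])
      fix z :: "nat \<Rightarrow> int" assume "(\<Sum>j<d1 + d2. \<bar>z j\<bar>) \<le> int (10 ^ 12 * (s1 + s2))"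
      \<comment> \<open>Net points are extensional, so z is replaced by its restriction, which has
        the same joint synthesis.\<close>
      then have "restrict z {..<d} \<in> int_net d (10 ^ 12 * s)"
        unfolding s_def[symmetric] d_def[symmetric] by (rule restrict_mem_int_net)
      from net[OF A this]
      have "sqrt m * \<sigma> / 3 * L2_set (?S (\<lambda>j. real_of_int (restrict z {..<d} j))) {..<n} \<le> L2_set (mat_vec n A (?S (\<lambda>j. real_of_int (restrict z {..<d} j)))) {..<m}
        \<and> L2_set (mat_vec n A (?S (\<lambda>j. real_of_int (restrict z {..<d} j)))) {..<m} \<le> 3 * sqrt m * \<sigma> * L2_set (?S (\<lambda>j. real_of_int (restrict z {..<d} j))) {..<n}" .
      moreover have "?S (\<lambda>j. real_of_int (restrict z {..<d} j)) = ?S (\<lambda>j. real_of_int (z j))"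
        by (rule joint_synthesis_cong) (simp add: d_def)
      ultimately show "sqrt m * \<sigma> / 3 * L2_set (?S (\<lambda>j. real_of_int (z j))) {..<n} \<le> L2_set (mat_vec n A (?S (\<lambda>j. real_of_int (z j)))) {..<m}
        \<and> L2_set (mat_vec n A (?S (\<lambda>j. real_of_int (z j)))) {..<m} \<le> 3 * (sqrt m * \<sigma>) * L2_set (?S (\<lambda>j. real_of_int (z j))) {..<n}"
        by (simp only: mult.assoc)
    qed (use \<mu> \<mu>7 s in \<open>auto simp: s_def\<close>)
    also have "(22 * ?e) powr (1 / q) = 22 powr (1 / q) * ?e powr (1 / q)"
      by (rule powr_mult)
    also have "real (d1 + d2) * (22 powr (1 / q) * ?e powr (1 / q)) = C * ?e powr (1 / q) / real (s1 + s2) powr (1 / q - 1 / 2)"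
      unfolding C_def s_def[symmetric] d_def[symmetric] using s by simp
    finally show "l2norm n (\<lambda>i. g1 i - f1 i) + l2norm n (\<lambda>i. g2 i - f2 i)
       \<le> C * ?e powr (1 / q) / real (s1 + s2) powr (1 / q - 1 / 2)" .
  qed
qed

end
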